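(* For any constant $c \in (0, \tfrac{1}{8})$ there exists a deterministic algorithm $\mathcal{P}$ such that, given as input a matrix $\bm{R}$ sampled from $\mathcal{M}_{n,\mu}$ with $|\mu| \ge (\ln n)^{-c}$ and a real number $\varepsilon \in (0,1)$, it computes in time $n^{\mathcal{O}(\ln n + \ln \frac{1}{\varepsilon})}$ a complex number $\mathcal{P}(\bm{R},\varepsilon)$ such that \[ \Pr\left( \left| 1 - \frac{\mathcal{P}(\bm{R},\varepsilon)}{\operatorname{Per}(\bm{R})} \right| \le \varepsilon \right) \ge 1 - o(1), \] where the probability is over the random matrix $\bm{R}$ and $o(1)$ is as $n \to \infty$.
   Context: For $\mu \in \mathbb{C}$, $\mathcal{D}_\mu$ denotes a probability distribution on $\mathbb{C}$ with $\mathbb{E}_{x\sim\mathcal{D}_\mu}[x]=\mu$, variance $\mathbb{E}|x-\mu|^2 = 1$, and $\mathbb{E}|x-\mu|^3 = \rho < \infty$. $\mathcal{M}_{n,\mu}$ denotes the distribution of $n\times n$ complex matrices whose entries are i.i.d. samples from $\mathcal{D}_\mu$. $\operatorname{Per}(\bm{R}) = \sum_{\sigma \in S_n}\prod_{i=1}^n R_{i,\sigma(i)}$ is the permanent. *)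

theory Defs
  imports "HOL-Probability.Probability" "HOL-Combinatorics.Permutations"
    "HOL-Library.Landau_Symbols"
begin

section \<open>Random matrices and the permanent\<close>

text \<open>
  An \<open>n \<times> n\<close> matrix is a function on \<open>nat \<times> nat\<close> of which only the entries with both indices
  below \<open>n\<close> matter.
\<close>

type_synonym cmatrix = "nat \<times> nat \<Rightarrow> complex"

definition per :: "nat \<Rightarrow> cmatrix \<Rightarrow> complex" where
  "per n R = (\<Sum>\<sigma> | \<sigma> permutes {..<n}. \<Prod>i<n. R (i, \<sigma> i))"

text \<open>
  Integrability of \<open>x\<close> and of \<open>(norm (x - \<mu>))\<^sup>2\<close> follows from that of the third absolute
  moment, since \<open>D\<close> is a probability measure.
\<close>

definition entry_distribution :: "complex \<Rightarrow> real \<Rightarrow> complex measure \<Rightarrow> bool" where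
  "entry_distribution \<mu> \<rho> D \<longleftrightarrow>
     prob_space D \<and> sets D = sets borel \<and>
     integrable D (\<lambda>x. norm (x - \<mu>) ^ 3) \<and>
     (LINT x|D. x) = \<mu> \<and>
     (LINT x|D. norm (x - \<mu>) ^ 2) = 1 \<and>
     (LINT x|D. norm (x - \<mu>) ^ 3) = \<rho>"

definition iid_matrix :: "nat \<Rightarrow> complex measure \<Rightarrow> cmatrix measure" where
  "iid_matrix n D = Pi\<^sub>M ({..<n} \<times> {..<n}) (\<lambda>_. D)"


section \<open>Algorithms on complex numbers\<close>

text \<open>
  Since the inputs are arbitrary complex numbers, algorithms are programs for a unit-cost random
  access machine with exact arithmetic (a real RAM, i.e. the Blum-Shub-Smale model with indirect
  addressing). A state consists of an index memory of natural numbers, used for control and for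
  addressing, and a number memory of complex numbers.

  The power of the machine is deliberately limited as follows. The only constants are natural
  numbers and the imaginary unit, so that no information is hidden in constants. Indices have
  addition and truncated subtraction but no multiplication, and there is no rounding, hence no way
  to turn a number into an index except by comparisons. A program is one fixed finite object
  that serves all dimensions and all accuracies.
\<close>

datatype iexp =
    IConst nat
  | IMem iexp
  | IAdd iexp iexp
  | ISub iexp iexp

datatype nexp =
    NOfIndex iexp
  | NImagUnit
  | NMem iexp
  | NRe nexp
  | NAdd nexp nexp
  | NSub nexp nexp
  | NMul nexp nexp
  | NDiv nexp nexp

datatype test =
    ILess iexp iexp
  | NLe nexp nexp
  | Neg test
  | Conj test test

datatype com =
    Skip
  | IAssign iexp iexp
  | NAssign iexp nexp
  | Seq com com
  | Cond test com com
  | While test com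

type_synonym state = "(nat \<Rightarrow> nat) \<times> (nat \<Rightarrow> complex)"

fun ival :: "iexp \<Rightarrow> state \<Rightarrow> nat" where
  "ival (IConst k) s = k"
| "ival (IMem a) s = fst s (ival a s)"
| "ival (IAdd a b) s = ival a s + ival b s"
| "ival (ISub a b) s = ival a s - ival b s"

text \<open>Division is total, with \<open>x / 0 = 0\<close>; a program can test for zero beforehand.\<close>

fun nval :: "nexp \<Rightarrow> state \<Rightarrow> complex" where
  "nval (NOfIndex a) s = of_nat (ival a s)"
| "nval NImagUnit s = \<i>"
| "nval (NMem a) s = snd s (ival a s)"
| "nval (NRe x) s = of_real (Re (nval x s))"
| "nval (NAdd x y) s = nval x s + nval y s"
| "nval (NSub x y) s = nval x s - nval y s"
| "nval (NMul x y) s = nval x s * nval y s"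
| "nval (NDiv x y) s = nval x s / nval y s"

text \<open>
  The order test compares real parts; imaginary parts are reached by multiplying with \<open>\<i>\<close>.
\<close>

fun holds :: "test \<Rightarrow> state \<Rightarrow> bool" where
  "holds (ILess a b) s \<longleftrightarrow> ival a s < ival b s"
| "holds (NLe x y) s \<longleftrightarrow> Re (nval x s) \<le> Re (nval y s)"
| "holds (Neg b) s \<longleftrightarrow> \<not> holds b s"
| "holds (Conj b b') s \<longleftrightarrow> holds b s \<and> holds b' s"

fun icost :: "iexp \<Rightarrow> nat" where
  "icost (IConst k) = 1"
| "icost (IMem a) = 1 + icost a"
| "icost (IAdd a b) = 1 + icost a + icost b"
| "icost (ISub a b) = 1 + icost a + icost b"

fun ncost :: "nexp \<Rightarrow> nat" where
  "ncost (NOfIndex a) = 1 + icost a"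
| "ncost NImagUnit = 1"
| "ncost (NMem a) = 1 + icost a"
| "ncost (NRe x) = 1 + ncost x"
| "ncost (NAdd x y) = 1 + ncost x + ncost y"
| "ncost (NSub x y) = 1 + ncost x + ncost y"
| "ncost (NMul x y) = 1 + ncost x + ncost y"
| "ncost (NDiv x y) = 1 + ncost x + ncost y"

fun test_cost :: "test \<Rightarrow> nat" where
  "test_cost (ILess a b) = 1 + icost a + icost b"
| "test_cost (NLe x y) = 1 + ncost x + ncost y"
| "test_cost (Neg b) = 1 + test_cost b"
| "test_cost (Conj b b') = 1 + test_cost b + test_cost b'"

text \<open>
  \<open>exec p s t s'\<close>: started in state \<open>s\<close>, program \<open>p\<close> halts in state \<open>s'\<close> after
  \<open>t\<close> elementary operations. There is no derivation for a diverging run.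
\<close>

inductive exec :: "com \<Rightarrow> state \<Rightarrow> nat \<Rightarrow> state \<Rightarrow> bool" where
  Skip: "exec Skip s 1 s"
| IAssign: "exec (IAssign a e) s (1 + icost a + icost e) ((fst s)(ival a s := ival e s), snd s)"
| NAssign: "exec (NAssign a x) s (1 + icost a + ncost x) (fst s, (snd s)(ival a s := nval x s))"
| Seq: "exec p s t s' \<Longrightarrow> exec q s' t' s'' \<Longrightarrow> exec (Seq p q) s (t + t') s''"
| CondTrue: "holds b s \<Longrightarrow> exec p s t s' \<Longrightarrow> exec (Cond b p q) s (test_cost b + t) s'"
| CondFalse: "\<not> holds b s \<Longrightarrow> exec q s t s' \<Longrightarrow> exec (Cond b p q) s (test_cost b + t) s'"
| WhileFalse: "\<not> holds b s \<Longrightarrow> exec (While b p) s (test_cost b) s"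
| WhileTrue: "holds b s \<Longrightarrow> exec p s t s' \<Longrightarrow> exec (While b p) s' t' s'' \<Longrightarrow>
    exec (While b p) s (test_cost b + t + t') s''"

lemma exec_deterministic:
  "exec p s t s' \<Longrightarrow> exec p s u s'' \<Longrightarrow> u = t \<and> s'' = s'"
proof (induction arbitrary: u s'' rule: exec.induct)
  case (Seq p s t s' q t' s2)
  from Seq.prems show ?case by cases (use Seq.IH in blast)
next
  case (WhileTrue b s p t s' t' s2)
  from WhileTrue.prems show ?case by cases (use WhileTrue.hyps WhileTrue.IH in blast)+
next
  case (CondTrue b s p t s' q)
  from CondTrue.prems show ?case by cases (use CondTrue.hyps CondTrue.IH in blast)+
next
  case (CondFalse b s q t s' p)
  from CondFalse.prems show ?case by cases (use CondFalse.hyps CondFalse.IH in blast)+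
next
  case (WhileFalse b s p)
  from WhileFalse.prems show ?case by cases (use WhileFalse.hyps in blast)+
qed (auto elim: exec.cases)

text \<open>
  The input is the dimension \<open>n\<close> (index cell 0), the accuracy \<open>\<epsilon>\<close> (number cell 0), and the
  matrix in row-major order (number cells 1 to \<open>n * n\<close>); all other cells hold 0. The output
  is read from number cell 0.
\<close>

definition input_state :: "nat \<Rightarrow> cmatrix \<Rightarrow> real \<Rightarrow> state" where
  "input_state n R \<epsilon> =
     ((\<lambda>a. if a = 0 then n else 0),
      (\<lambda>a. if a = 0 then of_real \<epsilon>
           else if a \<le> n * n then R ((a - 1) div n, (a - 1) mod n)
           else 0))"

definition computes_within :: "com \<Rightarrow> nat \<Rightarrow> cmatrix \<Rightarrow> real \<Rightarrow> complex \<Rightarrow> real \<Rightarrow> bool" where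
  "computes_within p n R \<epsilon> z T \<longleftrightarrow>
     (\<exists>t s. exec p (input_state n R \<epsilon>) t s \<and> snd s 0 = z \<and> real t \<le> T)"

end

theory Submission
  imports Defs "HOL-Real_Asymp.Real_Asymp"
begin

text \<open>
  Write \<open>A = R - \<mu>\<close>, \<open>z = 1 / \<mu>\<close> and, for a set \<open>S\<close> of cells, \<open>\<chi>\<^sub>S\<close> for the product of the
  entries of \<open>A\<close> over \<open>S\<close>; these monomials are orthonormal. Expanding the permanent gives
  \<open>per R = n! \<mu>^n q\<close>, where \<open>q\<close> is the sum of \<open>z^k (n - k)! / n! \<chi>\<^sub>S\<close> over all non-attacking rook
  placements \<open>S\<close>, \<open>k\<close> being the size of \<open>S\<close>.

  The permanent is bounded below by comparing \<open>q\<close> with the product \<open>G\<close> of all factors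
  \<open>1 + z A\<^sub>s / n\<close>, which is the same kind of sum over all sets of cells with weights \<open>(z / n)^k\<close>.
  By orthonormality \<open>E |q - G|^2 \<le> |z|^4 exp (|z|^2) / n\<close>. As the third moment forces all
  \<open>z A\<^sub>s / n\<close> to be small, \<open>|G|\<close> is at least \<open>exp (- |z X| - 5 |z|^2 Y)\<close> with
  \<open>X\<close> the sum of the entries of \<open>A\<close> divided by \<open>n\<close> and \<open>Y\<close> the mean of their squared moduli, so
  that \<open>|q| \<ge> n^(-1/4)\<close> with high probability.

  The algorithm cannot see \<open>\<mu>\<close>. It expands the permanent around the empirical mean instead and
  cuts off after placements of size \<open>t\<close>, where \<open>2^t \<epsilon> \<ge> n\<close>. Re-expanding around \<open>\<mu>\<close> turns the
  coefficients into a convolution with an exponential series in \<open>|z X|\<close>, and the tail is at most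
  \<open>2^(-t) exp (3 |z X|)\<close> times the sum of \<open>|2 z|^l |\<alpha>\<^sub>l|\<close>, where \<open>\<alpha>\<^sub>l\<close>, the coefficient of \<open>z^l\<close>
  in \<open>q\<close>, has second moment \<open>1 / l!\<close>.
\<close>

section \<open>Rook placements\<close>

definition rooks :: "nat \<Rightarrow> nat \<Rightarrow> (nat \<times> nat) set set" where
  "rooks n k = {S. S \<subseteq> {..<n} \<times> {..<n} \<and> inj_on fst S \<and> inj_on snd S \<and> card S = k}"

lemma finite_rooks [simp]: "finite (rooks n k)"
  by (rule finite_subset[of _ "Pow ({..<n} \<times> {..<n})"]) (auto simp: rooks_def)

lemma rooksD:
  assumes "S \<in> rooks n k"
  shows "S \<subseteq> {..<n} \<times> {..<n}" "inj_on fst S" "inj_on snd S" "card S = k" "finite S" "k \<le> n"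
proof -
  show *: "S \<subseteq> {..<n} \<times> {..<n}" "inj_on fst S" "inj_on snd S" "card S = k"
    using assms by (auto simp: rooks_def)
  then show "finite S" by (meson finite_SigmaI finite_lessThan finite_subset)
  have "card (fst ` S) \<le> card {..<n}" using * by (intro card_mono) auto
  then show "k \<le> n" using * by (simp add: card_image)
qed

lemma rooks_subset:
  assumes "T \<in> rooks n k" "U \<subseteq> T"
  shows "U \<in> rooks n (card U)"
  using assms by (auto simp: rooks_def inj_on_subset)

lemma rooks_gt: "n < k \<Longrightarrow> rooks n k = {}"
  using rooksD(6) by fastforce

lemma rooks_0 [simp]: "rooks n 0 = {{}}"
proof
  show "rooks n 0 \<subseteq> {{}}" using rooksD(4,5) by fastforce
qed (auto simp: rooks_def)

lemma insert_rooks_iff: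
  assumes "U \<in> rooks n l" "e \<notin> U"
  shows "insert e U \<in> rooks n (Suc l) \<longleftrightarrow> e \<in> ({..<n} - fst ` U) \<times> ({..<n} - snd ` U)"
  using assms rooksD(5)[OF assms(1)] unfolding rooks_def by (cases e) auto

text \<open>Double counting of the pairs of an extension \<open>T\<close> of \<open>U\<close> and a cell of \<open>T - U\<close>.\<close>

lemma rooks_extensions_step:
  assumes U: "U \<in> rooks n l" and lk: "l < k"
    and IH: "\<And>U'. U' \<in> rooks n (Suc l) \<Longrightarrow> card {T \<in> rooks n k. U' \<subseteq> T} = c"
  shows "card {T \<in> rooks n k. U \<subseteq> T} * (k - l) = (n - l)\<^sup>2 * c"
proof -
  let ?F = "({..<n} - fst ` U) \<times> ({..<n} - snd ` U)"
  let ?A = "SIGMA T:{T \<in> rooks n k. U \<subseteq> T}. T - U"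
  let ?B = "SIGMA e:?F. {T \<in> rooks n k. insert e U \<subseteq> T}"
  note D = rooksD[OF U]
  have e: "insert e U \<in> rooks n (Suc l)" if "T \<in> rooks n k" "U \<subseteq> T" "e \<in> T - U" for e T
    using rooks_subset[of T n k "insert e U"] that D by auto
  have "bij_betw prod.swap ?A ?B"
  proof (rule bij_betwI[where g = prod.swap])
    show "prod.swap \<in> ?A \<rightarrow> ?B"
      using e insert_rooks_iff[OF U] by (fastforce simp: Pi_def)
    show "prod.swap \<in> ?B \<rightarrow> ?A"
      by (auto simp: image_iff)+
  qed auto
  then have "card ?A = card ?B" by (rule bij_betw_same_card)
  moreover have "card ?A = card {T \<in> rooks n k. U \<subseteq> T} * (k - l)"
  proof -
    have "card (T - U) = k - l" if "T \<in> {T \<in> rooks n k. U \<subseteq> T}" for T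
      using that D rooksD(4,5)[of T n k] by (auto simp: card_Diff_subset)
    moreover have "finite (T - U)" if "T \<in> {T \<in> rooks n k. U \<subseteq> T}" for T
      using that rooksD(5)[of T n k] by auto
    ultimately show ?thesis by (subst card_SigmaI) auto
  qed
  moreover have "card ?B = (n - l)\<^sup>2 * c"
  proof -
    have "card ({..<n} - fst ` U) = n - l" "card ({..<n} - snd ` U) = n - l"
      using D by (subst card_Diff_subset; force simp: card_image)+
    then have "card ?F = (n - l)\<^sup>2" by (simp add: card_cartesian_product power2_eq_square)
    moreover have "card {T \<in> rooks n k. insert e U \<subseteq> T} = c" if "e \<in> ?F" for e
      using that insert_rooks_iff[OF U, of e] by (intro IH) force
    ultimately show ?thesis by (subst card_SigmaI) auto
  qed
  ultimately show ?thesis by simp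
qed

text \<open>Downward induction on \<open>l\<close> from \<open>l = k\<close>, where
  \<open>T = U\<close> is forced; the step is the double count above. The denominator stands on the
  left, which avoids division in the natural numbers.\<close>

lemma card_rooks_extensions:
  assumes "U \<in> rooks n l" "l \<le> k" "k \<le> n"
  shows "card {T \<in> rooks n k. U \<subseteq> T} * (fact (k - l) * (fact (n - k))\<^sup>2) = (fact (n - l))\<^sup>2"
  using assms(2,1)
proof (induction l arbitrary: U rule: inc_induct)
  case base
  have "T = U" if "T \<in> rooks n k" "U \<subseteq> T" for T
    using card_subset_eq[OF rooksD(5)[OF that(1)] that(2)] rooksD(4)[OF that(1)] rooksD(4)[OF base] by simp
  with base have "{T \<in> rooks n k. U \<subseteq> T} = {U}" by auto
  then show ?case by simp
next
  case (step l)
  define F :: nat where "F = fact (k - Suc l) * (fact (n - k))\<^sup>2"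
  have F: "F > 0" by (simp add: F_def)
  \<comment> \<open>The induction hypothesis gives the count only through its product with
    \<open>F\<close>, so the common value for all \<open>U'\<close> is recovered by
    division.\<close>
  define c where "c = (fact (n - Suc l))\<^sup>2 div F"
  have IH: "card {T \<in> rooks n k. U' \<subseteq> T} = c" if "U' \<in> rooks n (Suc l)" for U'
    using step.IH[OF that] F by (simp add: c_def F_def[symmetric] flip: step.IH[OF that])
  \<comment> \<open>A free cell exists because \<open>l < k\<close> and \<open>k \<le> n\<close>.
    Extending \<open>U\<close> by it shows that the division in \<open>c\<close> is exact.\<close>
  obtain e where e: "e \<notin> U" "e \<in> ({..<n} - fst ` U) \<times> ({..<n} - snd ` U)"
  proof -
    have "card (fst ` U) < card {..<n}" "card (snd ` U) < card {..<n}"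
      using rooksD[OF step.prems] step.hyps assms(3) by (auto simp: card_image)
    then obtain i j where "i < n" "i \<notin> fst ` U" "j < n" "j \<notin> snd ` U"
      using rooksD[OF step.prems]
      by (metis card_mono finite_imageI leD lessThan_iff subsetI)
    then show ?thesis by (intro that[of "(i, j)"]) force+
  qed
  have "insert e U \<in> rooks n (Suc l)" using insert_rooks_iff[OF step.prems e(1)] e(2) by blast
  from step.IH[OF this] IH[OF this] have c: "c * F = (fact (n - Suc l))\<^sup>2" by (simp add: F_def)
  have "card {T \<in> rooks n k. U \<subseteq> T} * (fact (k - l) * (fact (n - k))\<^sup>2) =
        card {T \<in> rooks n k. U \<subseteq> T} * (k - l) * F"
    using step.hyps by (simp add: F_def fact_reduce[of "k - l"])
  also have "\<dots> = (n - l)\<^sup>2 * (c * F)"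
    by (simp add: rooks_extensions_step[OF step.prems step.hyps(2) IH])
  also have "\<dots> = (fact (n - l))\<^sup>2"
    using step.hyps assms(3) by (simp add: c fact_reduce[of "n - l"] power_mult_distrib)
  finally show ?case .
qed

lemma card_rooks: "k \<le> n \<Longrightarrow> card (rooks n k) * (fact k * (fact (n - k))\<^sup>2) = (fact n)\<^sup>2"
  using card_rooks_extensions[of "{}" n 0 k] by simp

section \<open>Re-expansion of sums over placements and of the permanent\<close>

text \<open>Each product over \<open>T\<close> is expanded over the subsets \<open>U\<close> of
  \<open>T\<close> and the sums are exchanged; every \<open>U\<close> of size \<open>l\<close> lies
  in equally many \<open>T\<close>. The case \<open>k = n\<close> expands the permanent around any
  centre, and general \<open>k\<close> later moves the centre from the empirical mean to
  \<mu>.\<close>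

lemma sum_rooks_extensions:
  assumes "k \<le> n"
  shows "fact (n - k) * (\<Sum>T\<in>rooks n k. \<Prod>s\<in>T. f s + c) =
    (\<Sum>l\<le>k. (fact (n - l) * of_nat ((n - l) choose (k - l)) * c ^ (k - l)) *
      (\<Sum>U\<in>rooks n l. \<Prod>s\<in>U. f s :: complex))"
proof -
  have "(\<Sum>T\<in>rooks n k. \<Prod>s\<in>T. f s + c) = (\<Sum>T\<in>rooks n k. \<Sum>U\<in>Pow T. (\<Prod>s\<in>U. f s) * c ^ (k - card U))"
  proof (rule sum.cong[OF refl])
    fix T assume "T \<in> rooks n k"
    note T = rooksD[OF this]
    show "(\<Prod>s\<in>T. f s + c) = (\<Sum>U\<in>Pow T. (\<Prod>s\<in>U. f s) * c ^ (k - card U))"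
      unfolding prod_add[OF T(5)] using T finite_subset[OF _ T(5)]
      by (auto intro!: sum.cong simp: card_Diff_subset)
  qed
  also have "\<dots> = (\<Sum>T\<in>rooks n k. \<Sum>l\<le>k. \<Sum>U\<in>{U\<in>rooks n l. U \<subseteq> T}. (\<Prod>s\<in>U. f s) * c ^ (k - l))"
  proof (rule sum.cong[OF refl])
    fix T assume T: "T \<in> rooks n k"
    note TD = rooksD[OF T]
    have P: "Pow T = (\<Union>l\<le>k. {U\<in>rooks n l. U \<subseteq> T})"
      using rooks_subset[OF T] card_mono[OF TD(5)] TD(4) by auto
    show "(\<Sum>U\<in>Pow T. (\<Prod>s\<in>U. f s) * c ^ (k - card U)) =
      (\<Sum>l\<le>k. \<Sum>U\<in>{U\<in>rooks n l. U \<subseteq> T}. (\<Prod>s\<in>U. f s) * c ^ (k - l))"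
      unfolding P by (subst sum.UNION_disjoint) (auto dest: rooksD(4) intro!: sum.cong)
  qed
  also have "\<dots> = (\<Sum>l\<le>k. \<Sum>U\<in>rooks n l. \<Sum>T\<in>{T\<in>rooks n k. U \<subseteq> T}. (\<Prod>s\<in>U. f s) * c ^ (k - l))"
    by (subst sum.swap) (intro sum.cong refl sum.swap_restrict; simp)
  also have "fact (n - k) * \<dots> = (\<Sum>l\<le>k. (fact (n - l) * of_nat ((n - l) choose (k - l)) * c ^ (k - l)) *
      (\<Sum>U\<in>rooks n l. \<Prod>s\<in>U. f s))"
    unfolding sum_distrib_left
  proof (intro sum.cong refl)
    fix l U assume l: "l \<in> {..k}" and U: "U \<in> rooks n l"
    define N where "N = card {T \<in> rooks n k. U \<subseteq> T}"
    have 1: "of_nat N * (fact (k - l) * (fact (n - k))\<^sup>2) = ((fact (n - l))\<^sup>2 :: complex)"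
      using arg_cong[OF card_rooks_extensions[OF U, of k], of "of_nat :: nat \<Rightarrow> complex"] l assms by (simp add: N_def)
    have 2: "fact (k - l) * fact (n - k) * of_nat ((n - l) choose (k - l)) = (fact (n - l) :: complex)"
      using arg_cong[OF binomial_fact_lemma[of "k - l" "n - l"], of "of_nat :: nat \<Rightarrow> complex"] l assms by simp
    have "of_nat N * fact (n - k) * (fact (k - l) * fact (n - k)) =
        fact (n - l) * of_nat ((n - l) choose (k - l)) * (fact (k - l) * fact (n - k) :: complex)"
      using 1 2 by (simp add: power2_eq_square mult_ac)
    then have "of_nat N * fact (n - k) = (fact (n - l) * of_nat ((n - l) choose (k - l)) :: complex)"
      by (subst (asm) mult_right_cancel) auto
    then show "(\<Sum>T\<in>{T \<in> rooks n k. U \<subseteq> T}. fact (n - k) * ((\<Prod>s\<in>U. f s) * c ^ (k - l))) =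
       fact (n - l) * of_nat ((n - l) choose (k - l)) * c ^ (k - l) * (\<Prod>s\<in>U. f s)"
      by (simp add: N_def[symmetric] mult_ac)
  qed
  finally show ?thesis .
qed

text \<open>A full placement is the graph of a permutation. The inverse map reads off the column of
  each row and is the identity from \<open>n\<close> on, as \<open>permutes\<close> demands.\<close>

lemma per_eq_sum_rooks: "per n R = (\<Sum>S\<in>rooks n n. \<Prod>s\<in>S. R s)"
  unfolding per_def
proof (rule sum.reindex_bij_witness[where j = "\<lambda>\<sigma>. (\<lambda>i. (i, \<sigma> i)) ` {..<n}"
      and i = "\<lambda>S i. if i < n then THE j. (i, j) \<in> S else i"])
  fix \<sigma> assume "\<sigma> \<in> {\<sigma>. \<sigma> permutes {..<n}}"
  then have \<sigma>: "\<sigma> permutes {..<n}" by simp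
  show "(\<lambda>i. if i < n then THE j. (i, j) \<in> (\<lambda>i. (i, \<sigma> i)) ` {..<n} else i) = \<sigma>"
    using permutes_not_in[OF \<sigma>] by (auto simp: fun_eq_iff image_iff)
  show "(\<lambda>i. (i, \<sigma> i)) ` {..<n} \<in> rooks n n"
    using permutes_in_image[OF \<sigma>] permutes_inj[OF \<sigma>]
    by (auto simp: rooks_def inj_on_def card_image dest: injD)
  show "(\<Prod>s\<in>(\<lambda>i. (i, \<sigma> i)) ` {..<n}. R s) = (\<Prod>i<n. R (i, \<sigma> i))"
    by (subst prod.reindex) (auto simp: inj_on_def)
next
  fix S assume "S \<in> rooks n n"
  note S = rooksD[OF this]
  have fst: "fst ` S = {..<n}"
    using S by (intro card_subset_eq) (auto simp: card_image)
  have snd: "snd ` S = {..<n}"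
    using S by (intro card_subset_eq) (auto simp: card_image)
  define \<sigma> where "\<sigma> = (\<lambda>i. if i < n then THE j. (i, j) \<in> S else i)"
  have uniq: "\<exists>!j. (i, j) \<in> S" if "i < n" for i
  proof -
    from that fst obtain j where "(i, j) \<in> S" by (metis imageE lessThan_iff prod.collapse)
    with inj_onD[OF S(2)] show ?thesis by (metis fst_conv prod.inject)
  qed
  have mem: "(i, \<sigma> i) \<in> S" if "i < n" for i
    using theI'[OF uniq[OF that]] that by (simp add: \<sigma>_def)
  have eq: "(\<lambda>i. (i, \<sigma> i)) ` {..<n} = S"
  proof (rule card_subset_eq[OF S(5)])
    show "(\<lambda>i. (i, \<sigma> i)) ` {..<n} \<subseteq> S" using mem by auto
    show "card ((\<lambda>i. (i, \<sigma> i)) ` {..<n}) = card S" using S by (simp add: card_image inj_on_def)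
  qed
  then show "(\<lambda>i. (i, if i < n then THE j. (i, j) \<in> S else i)) ` {..<n} = S" by (simp add: \<sigma>_def)
  have "bij_betw \<sigma> {..<n} {..<n}"
  proof (rule bij_betw_imageI)
    have "snd ` S = \<sigma> ` {..<n}" unfolding eq[symmetric] by (simp add: image_image)
    then show "\<sigma> ` {..<n} = {..<n}" using snd by simp
    then show "inj_on \<sigma> {..<n}" by (simp add: eq_card_imp_inj_on)
  qed
  then have "\<sigma> permutes {..<n}" by (intro bij_imp_permutes) (auto simp: \<sigma>_def)
  then show "(\<lambda>i. if i < n then THE j. (i, j) \<in> S else i) \<in> {\<sigma>. \<sigma> permutes {..<n}}" by (simp add: \<sigma>_def)
qed

lemma per_shift:
  "per n R = (\<Sum>k\<le>n. fact (n - k) * m ^ (n - k) * (\<Sum>S\<in>rooks n k. \<Prod>s\<in>S. R s - m))"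
  using sum_rooks_extensions[of n n "\<lambda>s. R s - m" m] by (simp add: per_eq_sum_rooks)

section \<open>The program\<close>

text \<open>The postcondition also receives the number of operations. As \<open>exec\<close> is
  deterministic, asking for one terminating run loses nothing, and the rules below are equivalences
  fit for rewriting.\<close>

definition wp :: "com \<Rightarrow> state \<Rightarrow> (nat \<Rightarrow> state \<Rightarrow> bool) \<Rightarrow> bool" where
  "wp p s Q \<longleftrightarrow> (\<exists>t s'. exec p s t s' \<and> Q t s')"

lemma wp_IAssign [simp]:
  "wp (IAssign a e) s Q \<longleftrightarrow> Q (1 + icost a + icost e) ((fst s)(ival a s := ival e s), snd s)"
  unfolding wp_def by (blast intro: exec.IAssign elim: exec.cases dest: exec_deterministic[OF exec.IAssign])

lemma wp_NAssign [simp]: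
  "wp (NAssign a x) s Q \<longleftrightarrow> Q (1 + icost a + ncost x) (fst s, (snd s)(ival a s := nval x s))"
  unfolding wp_def by (blast intro: exec.NAssign dest: exec_deterministic[OF exec.NAssign])

lemma wp_Seq [simp]:
  "wp (Seq p q) s Q \<longleftrightarrow> wp p s (\<lambda>t s'. wp q s' (\<lambda>t'. Q (t + t')))"
  unfolding wp_def
proof safe
  fix t s' assume "exec (Seq p q) s t s'" "Q t s'"
  then show "\<exists>t s'. exec p s t s' \<and> (\<exists>t' s''. exec q s' t' s'' \<and> Q (t + t') s'')"
    by cases blast
qed (blast intro: exec.Seq)

lemma wp_Cond [simp]:
  "wp (Cond b p q) s Q \<longleftrightarrow>
     (if holds b s then wp p s (\<lambda>t. Q (test_cost b + t)) else wp q s (\<lambda>t. Q (test_cost b + t)))"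
proof -
  have "wp p s (\<lambda>t. Q (test_cost b + t))" if "holds b s" "exec (Cond b p q) s t s'" "Q t s'" for t s'
    using that(2,1,3) unfolding wp_def by cases blast+
  moreover have "wp q s (\<lambda>t. Q (test_cost b + t))" if "\<not> holds b s" "exec (Cond b p q) s t s'" "Q t s'" for t s'
    using that(2,1,3) unfolding wp_def by cases blast+
  ultimately show ?thesis
    unfolding wp_def by (auto intro: exec.CondTrue exec.CondFalse)
qed

text \<open>The invariant is indexed by the rounds done, so the loop makes exactly \<open>N\<close>
  rounds; termination and cost come out together by induction on the rounds left.\<close>

lemma wp_While:
  assumes init: "I 0 s"
    and step: "\<And>i s. i < N \<Longrightarrow> I i s \<Longrightarrow> holds b s \<and> wp p s (\<lambda>t s'. t \<le> T \<and> I (Suc i) s')"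
    and stop: "\<And>s. I N s \<Longrightarrow> \<not> holds b s"
    and post: "\<And>t s'. t \<le> N * (T + test_cost b) + test_cost b \<Longrightarrow> I N s' \<Longrightarrow> Q t s'"
  shows "wp (While b p) s Q"
proof -
  have "\<exists>t s'. exec (While b p) s t s' \<and> t \<le> j * (T + test_cost b) + test_cost b \<and> I N s'"
    if "j \<le> N" "I (N - j) s" for j s
    using that
  proof (induction j arbitrary: s)
    case 0
    then have "I N s" by simp
    with stop[of s] exec.WhileFalse[of b s p]
    have "exec (While b p) s (test_cost b) s \<and> test_cost b \<le> 0 * (T + test_cost b) + test_cost b \<and> I N s" by simp
    then show ?case by blast
  next
    case (Suc j)
    have "N - Suc j < N" "Suc (N - Suc j) = N - j" using Suc.prems by auto
    with step[of "N - Suc j" s] Suc.prems obtain t s' where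
      1: "holds b s" "exec p s t s'" "t \<le> T" "I (N - j) s'" unfolding wp_def by auto
    with Suc.IH[of s'] Suc.prems obtain t' s'' where
      2: "exec (While b p) s' t' s''" "t' \<le> j * (T + test_cost b) + test_cost b" "I N s''" by auto
    have "test_cost b + t + t' \<le> Suc j * (T + test_cost b) + test_cost b" using 1 2 by simp
    with exec.WhileTrue[OF 1(1,2) 2(1)] 2(3) show ?case by blast
  qed
  from this[of N s] init post show ?thesis unfolding wp_def by fastforce
qed

section \<open>Auxiliary loops\<close>

text \<open>Indices can only be added and subtracted, so quotient and remainder come from repeated
  subtraction, at a cost at most linear in the number divided.\<close>

definition divmod_loop :: "nat \<Rightarrow> nat \<Rightarrow> iexp \<Rightarrow> com" where
  "divmod_loop x q b =
     While (Neg (ILess (IMem (IConst x)) b))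
       (Seq (IAssign (IConst x) (ISub (IMem (IConst x)) b))
            (IAssign (IConst q) (IAdd (IMem (IConst q)) (IConst 1))))"

lemma wp_divmod_loop:
  assumes "x \<noteq> q" "0 < v" "\<And>y z. ival b (f(x := y, q := z), g) = v" "f q = 0"
    and "\<And>t. t \<le> f x * (2 * icost b + 15) + icost b + 4 \<Longrightarrow> Q t (f(x := f x mod v, q := f x div v), g)"
  shows "wp (divmod_loop x q b) (f, g) Q"
proof -
  define I where "I = (\<lambda>i s. s = (f(x := f x - i * v, q := i), g) \<and> i * v \<le> f x)"
  note b = assms(3)
  have b': "ival b (f(x := y), g) = v" for y
    using b[of y "(f(x := y)) q"] by (simp only: fun_upd_triv)
  have b'': "ival b (f(q := z, x := y), g) = v" for y z
    using b[of y z] assms(1) by (simp add: fun_upd_twist)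
  show ?thesis unfolding divmod_loop_def
  proof (rule wp_While[where I = I and N = "f x div v" and T = "icost b + 11"])
    show "I 0 (f, g)" using assms by (auto simp: I_def)
  next
    fix i s assume i: "i < f x div v" and I: "I i s"
    from i have "Suc i * v \<le> f x"
      by (metis Suc_leI less_eq_div_iff_mult_less_eq assms(2))
    with I show "holds (Neg (ILess (IMem (IConst x)) b)) s \<and>
      wp (Seq (IAssign (IConst x) (ISub (IMem (IConst x)) b)) (IAssign (IConst q) (IAdd (IMem (IConst q)) (IConst 1)))) s
        (\<lambda>t s'. t \<le> icost b + 11 \<and> I (Suc i) s')"
      using assms(1) by (auto simp: I_def b b' b'' fun_upd_twist algebra_simps)
  next
    fix s assume "I (f x div v) s"
    then show "\<not> holds (Neg (ILess (IMem (IConst x)) b)) s"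
      using assms(1,2) by (auto simp: I_def b minus_div_mult_eq_mod)
  next
    fix t s' assume t: "t \<le> f x div v * (icost b + 11 + test_cost (Neg (ILess (IMem (IConst x)) b))) + test_cost (Neg (ILess (IMem (IConst x)) b))"
      and I: "I (f x div v) s'"
    have "f x div v * (icost b + 11 + test_cost (Neg (ILess (IMem (IConst x)) b))) \<le> f x * (2 * icost b + 15)"
      by (intro mult_mono div_le_dividend) auto
    then show "Q t s'" using I t assms(5)[of t] by (simp add: I_def minus_div_mult_eq_mod)
  qed
qed

text \<open>
  Registers of the index memory: 0 holds \<open>n\<close>, 1 holds \<open>n * n\<close>, 3 the number \<open>t\<close> of digits, 4 the
  successor of the current word, 5 its remaining digits, 6 the first admissible row, 7 the number
  of rooks placed, and \<open>12 + j\<close> a stamp for column \<open>j\<close>, which is in use iff its stamp equals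
  register 4, so that no stamp ever has to be reset. The number cells behind the matrix hold the
  empirical mean (\<open>n * n + 1\<close>), the number of words (\<open>n * n + 2\<close>) and the weight of the current
  placement (\<open>n * n + 3\<close>); cell 0 accumulates the result.
\<close>

abbreviation reg :: "nat \<Rightarrow> iexp" where "reg r \<equiv> IMem (IConst r)"
abbreviation num_addr :: "nat \<Rightarrow> iexp" where "num_addr j \<equiv> IAdd (reg 1) (IConst j)"
abbreviation num :: "nat \<Rightarrow> nexp" where "num j \<equiv> NMem (num_addr j)"

definition square_loop :: com where
  "square_loop = While (ILess (reg 2) (reg 0))
     (Seq (IAssign (IConst 1) (IAdd (reg 1) (reg 0))) (IAssign (IConst 2) (IAdd (reg 2) (IConst 1))))"

lemma wp_square_loop:
  assumes "f 1 = 0" "f 2 = 0"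
    and "\<And>t. t \<le> 20 * f 0 + 5 \<Longrightarrow> Q t (f(1 := f 0 * f 0, 2 := f 0), g)"
  shows "wp square_loop (f, g) Q"
  unfolding square_loop_def
  by (rule wp_While[where I = "\<lambda>i s. s = (f(1 := i * f 0, 2 := i), g)" and N = "f 0" and T = 15])
    (use assms in \<open>auto simp: fun_upd_twist fun_upd_idem\<close>)

definition sum_loop :: com where
  "sum_loop = While (ILess (reg 2) (reg 1))
     (Seq (IAssign (IConst 2) (IAdd (reg 2) (IConst 1))) (NAssign (num_addr 1) (NAdd (num 1) (NMem (reg 2)))))"

lemma wp_sum_loop:
  assumes "f 2 = 0" "g (Suc (f 1)) = 0"
    and "\<And>t. t \<le> 30 * f 1 + 5 \<Longrightarrow> Q t (f(2 := f 1), g(Suc (f 1) := sum g {1..f 1}))"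
  shows "wp sum_loop (f, g) Q"
  unfolding sum_loop_def
  by (rule wp_While[where I = "\<lambda>i s. s = (f(2 := i), g(Suc (f 1) := sum g {1..i}))" and N = "f 1" and T = 23])
    (use assms in \<open>auto simp: fun_upd_twist fun_upd_idem\<close>)

text \<open>The least \<open>t\<close> with \<open>(1 / 2) ^ t \<le> \<epsilon> / n\<close> for
  positive \<open>n\<close>. It is both the cut-off size of the expansion and the length of the
  words to be enumerated.\<close>

definition num_digits :: "nat \<Rightarrow> real \<Rightarrow> nat" where
  "num_digits n \<epsilon> = (LEAST t. real n \<le> 2 ^ t * \<epsilon>)"

lemma num_digits:
  assumes "0 < \<epsilon>"
  shows "real n \<le> 2 ^ num_digits n \<epsilon> * \<epsilon>" "t < num_digits n \<epsilon> \<Longrightarrow> 2 ^ t * \<epsilon> < real n"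
proof -
  obtain t where "real n / \<epsilon> < 2 ^ t" using real_arch_pow[of 2 "real n / \<epsilon>"] by auto
  then have "real n \<le> 2 ^ t * \<epsilon>" using assms by (simp add: field_simps)
  then show "real n \<le> 2 ^ num_digits n \<epsilon> * \<epsilon>" unfolding num_digits_def by (rule LeastI)
  show "t < num_digits n \<epsilon> \<Longrightarrow> 2 ^ t * \<epsilon> < real n" for t
    using not_less_Least[of t "\<lambda>t. real n \<le> 2 ^ t * \<epsilon>"] unfolding num_digits_def by auto
qed

text \<open>Doubling the accuracy in place until it reaches \<open>n\<close> finds \<open>t\<close>
  without logarithms. The number of words is built up alongside in the number memory, where products
  are available.\<close>

definition digits_loop :: com where
  "digits_loop = While (Neg (NLe (NOfIndex (reg 0)) (NMem (IConst 0))))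
     (Seq (NAssign (IConst 0) (NAdd (NMem (IConst 0)) (NMem (IConst 0))))
     (Seq (NAssign (num_addr 2) (NMul (num 2) (NOfIndex (IAdd (reg 1) (IConst 1)))))
          (IAssign (IConst 3) (IAdd (reg 3) (IConst 1)))))"

lemma wp_digits_loop:
  assumes "f 3 = 0" "g 0 = of_real \<epsilon>" "g (f 1 + 2) = 1" "0 < \<epsilon>"
    and "\<And>t. t \<le> 50 * num_digits (f 0) \<epsilon> + 10 \<Longrightarrow>
       Q t (f(3 := num_digits (f 0) \<epsilon>),
            g(0 := 2 ^ num_digits (f 0) \<epsilon> * of_real \<epsilon>, f 1 + 2 := of_nat ((f 1 + 1) ^ num_digits (f 0) \<epsilon>)))"
  shows "wp digits_loop (f, g) Q"
  unfolding digits_loop_def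
proof (rule wp_While[where N = "num_digits (f 0) \<epsilon>" and T = 40 and
      I = "\<lambda>i s. s = (f(3 := i), g(0 := of_real (2 ^ i * \<epsilon>), f 1 + 2 := of_nat ((f 1 + 1) ^ i)))"])
  show "(f, g) = (f(3 := 0), g(0 := of_real (2 ^ 0 * \<epsilon>), f 1 + 2 := of_nat ((f 1 + 1) ^ 0)))"
    using assms by (auto simp: fun_upd_idem)
qed (use assms num_digits(1)[OF assms(4), of "f 0"] num_digits(2)[OF assms(4), where n = "f 0"] in
    \<open>auto simp: fun_upd_twist not_le algebra_simps\<close>)

text \<open>Register 8 starts at the placement size \<open>k\<close> held in register 7, so their
  difference runs through 1 to \<open>n - k\<close> and yields \<open>fact (n - k)\<close> along
  with the powers of the mean.\<close>

definition weight_loop :: com where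
  "weight_loop = While (ILess (reg 8) (reg 0))
     (Seq (IAssign (IConst 8) (IAdd (reg 8) (IConst 1)))
          (NAssign (num_addr 3) (NMul (num 3) (NMul (num 1) (NOfIndex (ISub (reg 8) (reg 7)))))))"

lemma wp_weight_loop:
  assumes "f 8 = k" "f 7 = k"
    and "\<And>t. t \<le> 50 * f 0 + 5 \<Longrightarrow>
       Q t (f(8 := k + (f 0 - k)), g(f 1 + 3 := g (f 1 + 3) * (fact (f 0 - k) * g (f 1 + 1) ^ (f 0 - k))))"
  shows "wp weight_loop (f, g) Q"
  unfolding weight_loop_def
proof (rule wp_While[where N = "f 0 - k" and T = 40 and
      I = "\<lambda>i s. s = (f(8 := k + i), g(f 1 + 3 := g (f 1 + 3) * (fact i * g (f 1 + 1) ^ i)))"])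
qed (use assms in \<open>auto simp: fun_upd_twist fun_upd_idem algebra_simps\<close>)

text \<open>
  A word of \<open>t\<close> digits in base \<open>n * n + 1\<close>, least significant digit first, describes a rook
  placement: a digit \<open>d > 0\<close> puts a rook on the \<open>d\<close>-th cell in row-major order, in a later row
  than the previous one, and the digit 0, which sets the first admissible row to \<open>n\<close>, ends the
  word. Each placement of at most \<open>t\<close> rooks has exactly one such word, all other words have
  weight 0.
\<close>

fun word_term :: "nat \<Rightarrow> (nat \<times> nat \<Rightarrow> complex) \<Rightarrow> complex \<Rightarrow> nat \<Rightarrow> nat \<Rightarrow> nat \<Rightarrow> nat set \<Rightarrow> nat \<Rightarrow> complex \<Rightarrow> complex" where
  "word_term n B m 0 X r U k p = p * (fact (n - k) * m ^ (n - k))"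
| "word_term n B m (Suc t) X r U k p =
     (let d = X mod (n * n + 1); X' = X div (n * n + 1); i = (d - 1) div n; j = (d - 1) mod n in
      if d = 0 then word_term n B m t X' n U k p
      else if r \<le> i \<and> j \<notin> U then word_term n B m t X' (Suc i) (insert j U) (Suc k) (p * B (i, j))
      else word_term n B m t X' r U k 0)"

section \<open>Evaluating one word and summing over all words\<close>

text \<open>One unfolding of \<open>word_term\<close>. The digit left in register 5 is itself the
  address of the matrix entry it denotes; registers 10 and 11 receive its column and row, which
  decide admissibility.\<close>

definition digit_step :: com where
  "digit_step =
    Seq (IAssign (IConst 8) (IAdd (reg 8) (IConst 1)))
   (Seq (IAssign (IConst 9) (IConst 0))
   (Seq (divmod_loop 5 9 (IAdd (reg 1) (IConst 1)))
   (Seq (Cond (ILess (reg 5) (IConst 1))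
          (IAssign (IConst 6) (reg 0))
          (Seq (IAssign (IConst 10) (ISub (reg 5) (IConst 1)))
          (Seq (IAssign (IConst 11) (IConst 0))
          (Seq (divmod_loop 10 11 (reg 0))
               (Cond (Conj (Neg (ILess (reg 11) (reg 6))) (ILess (IMem (IAdd (IConst 12) (reg 10))) (reg 4)))
                 (Seq (IAssign (IConst 6) (IAdd (reg 11) (IConst 1)))
                 (Seq (IAssign (IAdd (IConst 12) (reg 10)) (reg 4))
                 (Seq (IAssign (IConst 7) (IAdd (reg 7) (IConst 1)))
                      (NAssign (num_addr 3) (NMul (num 3) (NSub (NMem (reg 5)) (num 1)))))))
                 (NAssign (num_addr 3) (NOfIndex (IConst 0))))))))
        (IAssign (IConst 5) (reg 9)))))"

text \<open>The value \<open>W\<close> of the whole word stays fixed while digits are consumed; the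
  used columns are read off the stamps. As stamps are at most \<open>Suc N\<close>, a stamp below
  register 4 means a free column. The bound on register 5 controls the cost of division.\<close>

definition word_inv :: "nat \<Rightarrow> (nat \<times> nat \<Rightarrow> complex) \<Rightarrow> complex \<Rightarrow> nat \<Rightarrow> nat \<Rightarrow> complex \<Rightarrow> complex \<Rightarrow> complex \<Rightarrow> nat \<Rightarrow> state \<Rightarrow> bool" where
  "word_inv n R m t N acc M W i s \<longleftrightarrow>
     fst s 0 = n \<and> fst s 1 = n * n \<and> fst s 3 = t \<and> fst s 4 = Suc N \<and> fst s 8 = i \<and> fst s 5 \<le> N \<and>
     (\<forall>j. fst s (12 + j) \<le> Suc N) \<and>
     (\<forall>a<n * n. snd s (Suc a) = R (a div n, a mod n)) \<and>
     snd s 0 = acc \<and> snd s (n * n + 1) = m \<and> snd s (n * n + 2) = M \<and>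
     word_term n (\<lambda>s. R s - m) m (t - i) (fst s 5) (fst s 6) {j. fst s (12 + j) = Suc N} (fst s 7)
       (snd s (n * n + 3)) = W"

lemma wp_digit_step:
  assumes "0 < n" "i < t" "word_inv n R m t N acc M W i s"
  shows "wp digit_step s (\<lambda>T s'. T \<le> 100 * (N + n * n + 1) \<and> word_inv n R m t N acc M W (Suc i) s')"
proof -
  obtain f g where s: "s = (f, g)" by (cases s)
  have I: "f 0 = n" "f 1 = n * n" "f 3 = t" "f 4 = Suc N" "f 8 = i" "f 5 \<le> N"
    "\<And>j. f (12 + j) \<le> Suc N" "\<And>a. a < n * n \<Longrightarrow> g (Suc a) = R (a div n, a mod n)"
    "g 0 = acc" "g (n * n + 1) = m" "g (n * n + 2) = M"
    "word_term n (\<lambda>s. R s - m) m (t - i) (f 5) (f 6) {j. f (12 + j) = Suc N} (f 7) (g (n * n + 3)) = W"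
    using assms(3) unfolding s word_inv_def by auto
  define d where "d = f 5 mod Suc (n * n)"
  define X where "X = f 5 div Suc (n * n)"
  have X: "X \<le> N" unfolding X_def using I(6) by (meson div_le_dividend le_trans)
  have d: "d \<le> n * n" "d \<le> N" unfolding d_def using I(6)
    by (simp_all add: less_Suc_eq_le[symmetric] le_less_trans[OF mod_less_eq_dividend])
  obtain t' where t': "t - i = Suc t'" "t - Suc i = t'" using assms(2) by (metis Suc_diff_Suc)
  note W = I(12)[unfolded t' word_term.simps Let_def Suc_eq_plus1[symmetric], folded X_def d_def]
  have I': "f (Suc 0) = n * n" "g (Suc (n * n)) = m" using I(2,10) by simp_all
  define a where "a = (d - Suc 0) div n"
  define b where "b = (d - Suc 0) mod n"
  have Rd: "g d = R (a, b)" if "0 < d"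
    using I(8)[of "d - 1"] that d by (simp add: a_def b_def)
  \<comment> \<open>The three outcomes of a digit follow: the word ends, a rook is placed, or the
    digit is rejected and the weight becomes 0.\<close>
  have stop: "word_inv n R m t N acc M W (Suc i) (f(8 := Suc i, 9 := X, 6 := n, 5 := X), g)" if "d = 0"
    unfolding word_inv_def using that W I X by (simp add: t')
  have take: "word_inv n R m t N acc M W (Suc i)
      (f(8 := Suc i, 5 := d, 9 := X, 10 := b, 11 := a, 6 := Suc a, 12 + b := Suc N, 7 := Suc (f 7), 5 := X),
       g(n * n + 3 := g (n * n + 3) * (g d - m)))"
    if "0 < d" "f 6 \<le> a" "f (12 + b) < Suc N"
  proof -
    have "{j. j \<noteq> b \<longrightarrow> f (12 + j) = Suc N} = insert b {j. f (12 + j) = Suc N}" by auto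
    then show ?thesis
      unfolding word_inv_def using that W I(1-11) X Rd by (simp add: t' a_def[symmetric] b_def[symmetric])
  qed
  have drop: "word_inv n R m t N acc M W (Suc i)
      (f(8 := Suc i, 5 := d, 9 := X, 10 := b, 11 := a, 5 := X), g(n * n + 3 := 0))"
    if "0 < d" "a < f 6 \<or> \<not> f (12 + b) < Suc N"
    unfolding word_inv_def using that W I(1-11) X I(7)[of b]
    by (auto simp add: t' a_def[symmetric] b_def[symmetric])
  show ?thesis unfolding s digit_step_def
    apply (simp add: I I')
    apply (rule wp_divmod_loop[where v = "Suc (n * n)"])
        apply (simp_all add: I I' flip: d_def X_def)
    apply (intro conjI impI)
    subgoal using I(6) by simp
    subgoal using stop by simp
    apply (rule wp_divmod_loop[where v = "n"])
        apply (simp_all add: I I' assms(1) flip: a_def b_def)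
    apply (intro conjI impI)
    using take drop I(6) d by (auto simp: not_less)
qed

text \<open>Register 4 is raised before the digits are read, so word \<open>N\<close> stamps with
  \<open>N + 1\<close>, which exceeds the initial 0 and all stamps of earlier words.\<close>

definition words_body :: com where
  "words_body =
     Seq (IAssign (IConst 5) (reg 4))
    (Seq (IAssign (IConst 6) (IConst 0))
    (Seq (IAssign (IConst 7) (IConst 0))
    (Seq (IAssign (IConst 8) (IConst 0))
    (Seq (NAssign (num_addr 3) (NOfIndex (IConst 1)))
    (Seq (IAssign (IConst 4) (IAdd (reg 4) (IConst 1)))
    (Seq (While (ILess (reg 8) (reg 3)) digit_step)
    (Seq (IAssign (IConst 8) (reg 7))
    (Seq weight_loop
         (NAssign (IConst 0) (NAdd (NMem (IConst 0)) (num 3)))))))))))"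

definition words_loop :: com where
  "words_loop = While (Neg (NLe (num 2) (NOfIndex (reg 4)))) words_body"

definition words_inv :: "nat \<Rightarrow> (nat \<times> nat \<Rightarrow> complex) \<Rightarrow> complex \<Rightarrow> nat \<Rightarrow> nat \<Rightarrow> nat \<Rightarrow> state \<Rightarrow> bool" where
  "words_inv n R m t V N s \<longleftrightarrow>
     fst s 0 = n \<and> fst s 1 = n * n \<and> fst s 3 = t \<and> fst s 4 = N \<and>
     (\<forall>j. fst s (12 + j) \<le> N) \<and>
     (\<forall>a<n * n. snd s (Suc a) = R (a div n, a mod n)) \<and>
     snd s 0 = (\<Sum>N'<N. word_term n (\<lambda>s. R s - m) m t N' 0 {} 0 1) \<and>
     snd s (n * n + 1) = m \<and> snd s (n * n + 2) = of_nat V"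

lemma wp_words_loop:
  assumes "0 < n" "words_inv n R m t V 0 s"
    and post: "\<And>T s'. T \<le> V * (400 * (t + 1) * (V + n * n + 1)) + 20 \<Longrightarrow>
      snd s' 0 = (\<Sum>N<V. word_term n (\<lambda>s. R s - m) m t N 0 {} 0 1) \<Longrightarrow> Q T s'"
  shows "wp words_loop s Q"
  unfolding words_loop_def
proof (rule wp_While[where I = "words_inv n R m t V" and N = V and T = "300 * (t + 1) * (V + n * n + 1)"])
  fix N s assume N: "N < V" and "words_inv n R m t V N s"
  moreover obtain f g where s: "s = (f, g)" by (cases s)
  ultimately have I: "f 0 = n" "f 1 = n * n" "f (Suc 0) = n * n" "f 3 = t" "f 4 = N" "\<And>j. f (12 + j) \<le> N"
    "\<And>a. a < n * n \<Longrightarrow> g (Suc a) = R (a div n, a mod n)"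
    "g 0 = (\<Sum>N'<N. word_term n (\<lambda>s. R s - m) m t N' 0 {} 0 1)" 
    "g (Suc (n * n)) = m" "g (Suc (Suc (n * n))) = of_nat V"
    by (auto simp: words_inv_def)
  define W where "W = word_term n (\<lambda>s. R s - m) m t N 0 {} 0 1"
  have "f (12 + j) \<noteq> Suc N" for j using I(6)[of j] by simp
  then have "{j. f (12 + j) = Suc N} = {}" by simp
  then have start: "word_inv n R m t N (g 0) (of_nat V) W 0
      (f(5 := N, 6 := 0, 7 := 0, 8 := 0, 4 := Suc N), g(n * n + 3 := 1))"
    unfolding word_inv_def using I by (simp add: le_SucI W_def)
  \<comment> \<open>\<open>T\<close> is the cost of the digit loop and \<open>T'\<close> that of the
    weight loop. The constant 260 leaves 40 of 300 for the assignments of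
    \<open>words_body\<close>.\<close>
  have time: "T + T' \<le> 260 + (300 * t + (300 + 300 * t) * (V + n * n))"
    if "T \<le> 5 + t * (105 + 100 * (N + n * n))" "T' \<le> 5 + n * 50" for T T'
  proof -
    define q where "q = n * n"
    have q: "n \<le> q" by (simp add: q_def)
    have "t * (105 + 100 * (N + q)) \<le> t * (300 + 300 * (V + q))"
      using N by (intro mult_left_mono) auto
    then show ?thesis using that q unfolding q_def[symmetric] by (simp add: algebra_simps)
  qed
  show "holds (Neg (NLe (num 2) (NOfIndex (reg 4)))) s \<and> wp words_body s
     (\<lambda>T s'. T \<le> 300 * (t + 1) * (V + n * n + 1) \<and> words_inv n R m t V (Suc N) s')"
    apply (simp add: s I N words_body_def not_le)
    apply (rule wp_While[where I = "word_inv n R m t N (g 0) (of_nat V) W" and N = t and T = "100 * (N + n * n + 1)"])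
    subgoal using start by simp
    subgoal by (rule conjI, simp add: word_inv_def, rule wp_digit_step[OF assms(1)])
    subgoal by (auto simp: word_inv_def)
    subgoal for T s'
      apply (cases s')
      subgoal for f' g'
        apply simp
        apply (rule wp_weight_loop[where k = "f' 7"])
          apply (simp_all add: word_inv_def words_inv_def)
        subgoal for T' using time[of T T'] I(8) W_def by simp
        done
      done
    done
qed (use assms in \<open>auto simp: words_inv_def algebra_simps\<close>)

text \<open>\<open>digits_loop\<close> overwrites the accuracy in number cell 0; the cell is cleared
  afterwards to become the accumulator.\<close>

definition rook_prog :: com where
  "rook_prog =
     Seq square_loop
    (Seq (IAssign (IConst 2) (IConst 0))
    (Seq sum_loop
    (Seq (NAssign (num_addr 1) (NDiv (num 1) (NOfIndex (reg 1))))
    (Seq (NAssign (num_addr 2) (NOfIndex (IConst 1)))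
    (Seq digits_loop
    (Seq (NAssign (IConst 0) (NOfIndex (IConst 0)))
         words_loop))))))"

definition matrix_mean :: "nat \<Rightarrow> cmatrix \<Rightarrow> complex" where
  "matrix_mean n R = (\<Sum>s\<in>{..<n} \<times> {..<n}. R s) / of_nat (n * n)"

lemma bij_betw_cells: "bij_betw (\<lambda>a. (a div n, a mod n)) {..<n * n} ({..<n} \<times> {..<n::nat})"
proof (rule bij_betwI[where g = "\<lambda>(i, j). i * n + j"])
  show "(\<lambda>(i, j). i * n + j) \<in> {..<n} \<times> {..<n} \<rightarrow> {..<n * n}"
  proof (clarsimp)
    fix i j assume "i < n" "j < n"
    then have "i * n + j < Suc i * n" by simp
    also have "\<dots> \<le> n * n" using \<open>i < n\<close> by (intro mult_right_mono) auto
    finally show "i * n + j < n * n" .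
  qed
  show "(\<lambda>a. (a div n, a mod n)) \<in> {..<n * n} \<rightarrow> {..<n} \<times> {..<n}"
    by (auto simp: less_mult_imp_div_less intro!: mod_less_divisor Nat.gr0I)
qed auto

lemma wp_rook_prog:
  assumes "0 < n" "0 < \<epsilon>"
  defines "t \<equiv> num_digits n \<epsilon>"
  defines "V \<equiv> (n * n + 1) ^ t"
  shows "wp rook_prog (input_state n R \<epsilon>) (\<lambda>T s.
    T \<le> V * (400 * (t + 1) * (V + n * n + 1)) + 50 * t + 20 * n + 100 * (n * n + 1) \<and>
    snd s 0 = (\<Sum>N<V. word_term n (\<lambda>s. R s - matrix_mean n R) (matrix_mean n R) t N 0 {} 0 1))"
proof -
  have sum: "sum (snd (input_state n R \<epsilon>)) {Suc 0..n * n} = matrix_mean n R * of_nat (n * n)"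
  proof -
    have "sum (snd (input_state n R \<epsilon>)) {Suc 0..n * n} = (\<Sum>a<n * n. R (a div n, a mod n))"
      by (rule sum.reindex_bij_witness[where i = Suc and j = "\<lambda>a. a - 1"]) (auto simp: input_state_def)
    also have "\<dots> = (\<Sum>s\<in>{..<n} \<times> {..<n}. R s)"
      by (rule sum.reindex_bij_betw[OF bij_betw_cells])
    finally show ?thesis using assms(1) by (simp add: matrix_mean_def)
  qed
  obtain f g where s: "input_state n R \<epsilon> = (f, g)" by (cases "input_state n R \<epsilon>")
  then have I: "f 0 = n" "\<And>j. 0 < j \<Longrightarrow> f j = 0" "g 0 = of_real \<epsilon>" "\<And>a. a < n * n \<Longrightarrow> g (Suc a) = R (a div n, a mod n)"
     "\<And>a. n * n < a \<Longrightarrow> g a = 0" "sum g {Suc 0..n * n} = matrix_mean n R * of_nat (n * n)"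
    using sum unfolding input_state_def by auto
  show ?thesis unfolding s rook_prog_def
    apply simp
    apply (rule wp_square_loop)
      apply (simp_all add: I)
    apply (rule wp_sum_loop)
      apply (simp_all add: I assms(1))
    apply (rule wp_digits_loop[where \<epsilon> = \<epsilon>])
        apply (simp_all add: I assms(1,2))
    apply (rule wp_words_loop[OF assms(1), where t = t and V = V and R = R and m = "matrix_mean n R"])
     apply (simp add: words_inv_def I t_def V_def)
    by (simp add: t_def)
qed

section \<open>Correctness of the enumeration\<close>

lemma word_term_zero [simp]: "word_term n B m t X r U k 0 = 0"
  by (induction t arbitrary: X r U k) (auto simp: Let_def)

text \<open>What the last \<open>t\<close> digits of a word can still add when \<open>r\<close> is
  the first admissible row and the columns in \<open>U\<close> are taken.\<close>

definition placements :: "nat \<Rightarrow> nat \<Rightarrow> nat \<Rightarrow> nat set \<Rightarrow> (nat \<times> nat) set set" where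
  "placements t n r U =
     {T. T \<subseteq> {r..<n} \<times> ({..<n} - U) \<and> inj_on fst T \<and> inj_on snd T \<and> card T \<le> t}"

lemma finite_placements [simp]: "finite (placements t n r U)"
  by (rule finite_subset[of _ "Pow ({r..<n} \<times> ({..<n} - U))"]) (auto simp: placements_def)

text \<open>From row \<open>n\<close> on nothing can be placed, however many digits remain; this is
  what makes the digit 0 an end marker.\<close>

lemma placements_trivial:
  "placements 0 n r U = {{}}" "placements t n n U = {{}}"
proof -
  have "finite T" if "T \<subseteq> {r..<n} \<times> ({..<n} - U)" for T
    using that by (rule finite_subset) simp
  then show "placements 0 n r U = {{}}" by (auto simp: placements_def)
  show "placements t n n U = {{}}" by (auto simp: placements_def)
qed

lemma placementsD:
  assumes "T \<in> placements t n r U"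
  shows "T \<subseteq> {r..<n} \<times> ({..<n} - U)" "inj_on fst T" "inj_on snd T" "card T \<le> t" "finite T"
proof -
  show *: "T \<subseteq> {r..<n} \<times> ({..<n} - U)" "inj_on fst T" "inj_on snd T" "card T \<le> t"
    using assms by (auto simp: placements_def)
  show "finite T" using *(1) by (rule finite_subset) simp
qed

text \<open>A nonempty placement is split at its rook in the topmost row.\<close>

lemma sum_placements_Suc:
  fixes f :: "(nat \<times> nat) set \<Rightarrow> complex"
  shows "(\<Sum>T\<in>placements (Suc t) n r U. f T) =
     f {} + (\<Sum>(i, j)\<in>{r..<n} \<times> ({..<n} - U). \<Sum>T\<in>placements t n (Suc i) (insert j U). f (insert (i, j) T))"
proof -
  define C where "C = {r..<n} \<times> ({..<n} - U)"
  define E where "E = (SIGMA c:C. placements t n (Suc (fst c)) (insert (snd c) U))"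
  define F where "F = (\<lambda>(c, T :: (nat \<times> nat) set). insert c T)"
  have E: "i < a" "j \<noteq> b" "(i, j) \<notin> T" if "((i, j), T) \<in> E" "(a, b) \<in> T" for i j T a b
    using that placementsD(1) unfolding E_def by fastforce+
  have notin: "c \<notin> T" if "(c, T) \<in> E" for c T
    using that placementsD(1) unfolding E_def by fastforce
  have "inj_on F E"
  proof (rule inj_onI)
    fix x y assume xy: "x \<in> E" "y \<in> E" "F x = F y"
    obtain c T c' T' where x: "x = (c, T)" and y: "y = (c', T')" by (cases x, cases y)
    have eq: "insert c T = insert c' T'" using xy by (simp add: F_def x y)
    have "c = c'"
    proof (rule ccontr)
      assume "c \<noteq> c'"
      then have "c \<in> T'" "c' \<in> T" using eq by auto
      then show False
        using E(1)[of "fst c" "snd c" T "fst c'" "snd c'"] E(1)[of "fst c'" "snd c'" T' "fst c" "snd c"] xy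
        by (simp add: x y)
    qed
    moreover have "T = T'" using eq notin xy \<open>c = c'\<close> unfolding x y by (metis insert_ident)
    ultimately show "x = y" by (simp add: x y)
  qed
  moreover have "F ` E = placements (Suc t) n r U - {{}}"
  proof (intro equalityI subsetI)
    fix S assume "S \<in> F ` E"
    then obtain i j T where S: "S = insert (i, j) T" and e: "((i, j), T) \<in> E" by (auto simp: F_def)
    then have T: "T \<in> placements t n (Suc i) (insert j U)" and c: "(i, j) \<in> C" by (auto simp: E_def)
    note TD = placementsD[OF T]
    have "i \<notin> fst ` T" "j \<notin> snd ` T" using TD(1) by force+
    moreover have "T \<subseteq> {r..<n} \<times> ({..<n} - U)" using TD(1) c by (force simp: C_def)
    ultimately show "S \<in> placements (Suc t) n r U - {{}}"
      using TD c notin[OF e] by (auto simp: placements_def S C_def)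
  next
    fix S assume S: "S \<in> placements (Suc t) n r U - {{}}"
    then have SD: "S \<subseteq> C" "inj_on fst S" "inj_on snd S" "card S \<le> Suc t" "finite S" "S \<noteq> {}"
      using placementsD[of S "Suc t" n r U] by (auto simp: C_def)
    have "Min (fst ` S) \<in> fst ` S" using SD by (intro Min_in) auto
    then obtain c where c: "c \<in> S" "fst c = Min (fst ` S)" by (metis imageE)
    define T where "T = S - {c}"
    have row: "fst c < fst e" if "e \<in> T" for e
    proof -
      have "fst c \<le> fst e" using that SD(5) by (simp add: c(2) T_def)
      moreover have "fst c \<noteq> fst e" using that c(1) inj_onD[OF SD(2), of c e] by (auto simp: T_def)
      ultimately show ?thesis by simp
    qed
    have col: "snd c \<noteq> snd e" if "e \<in> T" for e
      using that c(1) inj_onD[OF SD(3), of c e] by (auto simp: T_def)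
    have "T \<subseteq> {Suc (fst c)..<n} \<times> ({..<n} - insert (snd c) U)"
    proof
      fix e assume e: "e \<in> T"
      then have "e \<in> C" using SD(1) by (auto simp: T_def)
      then show "e \<in> {Suc (fst c)..<n} \<times> ({..<n} - insert (snd c) U)"
        using row[OF e] col[OF e] by (auto simp: C_def mem_Times_iff)
    qed
    moreover have "inj_on fst T" "inj_on snd T" using SD(2,3) by (auto simp: T_def inj_on_diff)
    moreover have "card T \<le> t" using SD c by (simp add: T_def)
    ultimately have "(c, T) \<in> E" using c(1) SD(1) by (auto simp: E_def placements_def)
    moreover have "S = F (c, T)" using c by (auto simp: F_def T_def)
    ultimately show "S \<in> F ` E" by blast
  qed
  ultimately have "bij_betw F E (placements (Suc t) n r U - {{}})" by (simp add: bij_betw_def)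
  then have "(\<Sum>T\<in>placements (Suc t) n r U - {{}}. f T) = (\<Sum>e\<in>E. f (F e))"
    by (rule sum.reindex_bij_betw[symmetric])
  also have "\<dots> = (\<Sum>c\<in>C. \<Sum>T\<in>placements t n (Suc (fst c)) (insert (snd c) U). f (insert c T))"
    unfolding E_def F_def by (subst sum.Sigma) (auto simp: C_def split_beta intro!: sum.cong)
  finally have "(\<Sum>T\<in>placements (Suc t) n r U - {{}}. f T) = \<dots>" .
  moreover have "{} \<in> placements (Suc t) n r U" by (simp add: placements_def)
  ultimately show ?thesis
    by (simp add: sum.remove[of _ "{}"] C_def split_beta)
qed

lemma sum_mod_div:
  fixes b v :: nat
  assumes "0 < b"
  shows "(\<Sum>N<b * v. f (N mod b) (N div b)) = (\<Sum>d<b. \<Sum>N<v. f d N :: complex)"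
proof -
  have "bij_betw (\<lambda>N. (N mod b, N div b)) {..<b * v} ({..<b} \<times> {..<v})"
  proof (rule bij_betwI[where g = "\<lambda>(d, N). d + b * N"])
    show "(\<lambda>(d, N). d + b * N) \<in> {..<b} \<times> {..<v} \<rightarrow> {..<b * v}"
    proof clarsimp
      fix d N assume "d < b" "N < v"
      then have "d + b * N < b * Suc N" by simp
      also have "\<dots> \<le> b * v" using \<open>N < v\<close> by (intro mult_left_mono) auto
      finally show "d + b * N < b * v" .
    qed
  qed (use assms in \<open>auto simp: less_mult_imp_div_less mult.commute\<close>)
  from sum.reindex_bij_betw[OF this, of "\<lambda>(d, N). f d N"] show ?thesis
    by (simp add: sum.cartesian_product)
qed

text \<open>Induction on the number of digits, splitting off the least significant one: 0 leaves the
  empty placement, a positive digit is the topmost rook. These are the two summands of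
  \<open>sum_placements_Suc\<close>.\<close>

lemma sum_word_term:
  assumes "0 < n"
  shows "(\<Sum>N<(n * n + 1) ^ t. word_term n B m t N r U k p) =
    (\<Sum>T\<in>placements t n r U. p * (\<Prod>s\<in>T. B s) * (fact (n - (k + card T)) * m ^ (n - (k + card T))))"
proof (induction t arbitrary: r U k p)
  case 0
  show ?case by (simp add: placements_trivial)
next
  case (Suc t)
  define v where "v = (n * n + 1) ^ t"
  define h where "h = (\<lambda>d N. let i = (d - 1) div n; j = (d - 1) mod n in
      if d = 0 then word_term n B m t N n U k p
      else if r \<le> i \<and> j \<notin> U then word_term n B m t N (Suc i) (insert j U) (Suc k) (p * B (i, j))
      else word_term n B m t N r U k 0)"
  define w where "w = (\<lambda>l. fact (n - l) * m ^ (n - l))"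
  have "(\<Sum>N<(n * n + 1) ^ Suc t. word_term n B m (Suc t) N r U k p) =
      (\<Sum>N<(n * n + 1) * v. h (N mod (n * n + 1)) (N div (n * n + 1)))"
    by (simp add: v_def h_def Let_def)
  also have "\<dots> = (\<Sum>d<n * n + 1. \<Sum>N<v. h d N)" by (rule sum_mod_div) simp
  also have "\<dots> = (\<Sum>N<v. h 0 N) + (\<Sum>a<n * n. \<Sum>N<v. h (Suc a) N)"
    by (simp add: sum.lessThan_Suc_shift del: sum.lessThan_Suc)
  also have "(\<Sum>N<v. h 0 N) = p * w k"
    using Suc.IH[of n U k p] by (simp add: h_def v_def placements_trivial w_def)
  also have "(\<Sum>a<n * n. \<Sum>N<v. h (Suc a) N) =
      (\<Sum>a<n * n. (\<lambda>(i, j). if r \<le> i \<and> j \<notin> U then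
         (\<Sum>T\<in>placements t n (Suc i) (insert j U). p * B (i, j) * (\<Prod>s\<in>T. B s) * w (Suc k + card T)) else 0)
       (a div n, a mod n))"
    using Suc.IH by (intro sum.cong refl) (auto simp: h_def v_def w_def Let_def)
  also have "\<dots> = (\<Sum>(i, j)\<in>{..<n} \<times> {..<n}. if r \<le> i \<and> j \<notin> U then
         (\<Sum>T\<in>placements t n (Suc i) (insert j U). p * B (i, j) * (\<Prod>s\<in>T. B s) * w (Suc k + card T)) else 0)"
    by (rule sum.reindex_bij_betw[OF bij_betw_cells])
  also have "\<dots> = (\<Sum>(i, j)\<in>{r..<n} \<times> ({..<n} - U).
         (\<Sum>T\<in>placements t n (Suc i) (insert j U). p * B (i, j) * (\<Prod>s\<in>T. B s) * w (Suc k + card T)))"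
    by (intro sum.mono_neutral_cong_right) (auto split: if_splits)
  also have "\<dots> = (\<Sum>(i, j)\<in>{r..<n} \<times> ({..<n} - U).
         (\<Sum>T\<in>placements t n (Suc i) (insert j U).
            p * (\<Prod>s\<in>insert (i, j) T. B s) * w (k + card (insert (i, j) T))))"
  proof (intro sum.cong refl, clarify, intro sum.cong refl)
    fix i j T assume "T \<in> placements t n (Suc i) (insert j U)"
    then have "finite T" "(i, j) \<notin> T" using placementsD(1,5) by fastforce+
    then show "p * B (i, j) * (\<Prod>s\<in>T. B s) * w (Suc k + card T) =
        p * (\<Prod>s\<in>insert (i, j) T. B s) * w (k + card (insert (i, j) T))" by (simp add: mult_ac)
  qed
  finally show ?case by (simp add: sum_placements_Suc w_def)
qed

text \<open>The expansion \<open>per_shift\<close> around the empirical mean, cut off after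
  placements of size \<open>t\<close>. If \<open>t\<close> exceeds \<open>n\<close>, the extra
  summands vanish as there are no such placements.\<close>

definition rook_approx :: "nat \<Rightarrow> nat \<Rightarrow> cmatrix \<Rightarrow> complex" where
  "rook_approx t n R = (\<Sum>k\<le>t. fact (n - k) * matrix_mean n R ^ (n - k) *
     (\<Sum>S\<in>rooks n k. \<Prod>s\<in>S. R s - matrix_mean n R))"

lemma rook_approx_eq:
  assumes "0 < n"
  shows "rook_approx t n R =
    (\<Sum>N<(n * n + 1) ^ t. word_term n (\<lambda>s. R s - matrix_mean n R) (matrix_mean n R) t N 0 {} 0 1)"
proof -
  have "placements t n 0 {} = (\<Union>k\<le>t. rooks n k)"
    by (auto simp: placements_def rooks_def lessThan_atLeast0)
  then show ?thesis
    unfolding sum_word_term[OF assms] rook_approx_def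
    by (simp, subst sum.UNION_disjoint)
       (auto simp: sum_distrib_left mult_ac dest: rooksD(4) intro!: sum.cong)
qed


section \<open>Running time\<close>

lemma num_digits_le:
  assumes "2 \<le> n" "0 < \<epsilon>" "\<epsilon> < 1"
  shows "real (num_digits n \<epsilon>) \<le> (ln (real n) + ln (1 / \<epsilon>)) / ln 2 + 1"
proof (cases "num_digits n \<epsilon>")
  case 0
  then show ?thesis using assms by simp
next
  case (Suc t)
  have "2 ^ t * \<epsilon> < real n" using num_digits(2)[OF assms(2), of t n] Suc by simp
  then have "ln (2 ^ t * \<epsilon>) < ln (real n)" using assms by (subst ln_less_cancel_iff) auto
  then have "real t * ln 2 \<le> ln (real n) + ln (1 / \<epsilon>)"
    using assms by (simp add: ln_mult ln_realpow ln_div)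
  then show ?thesis using Suc by (simp add: field_simps)
qed

text \<open>Everything is absorbed into powers of \<open>n \<ge> 2\<close>: a constant up to
  \<open>2 ^ j\<close> into \<open>n ^ j\<close>, \<open>n * n + 1\<close> into
  \<open>n ^ 3\<close>, and \<open>t + 1\<close> into \<open>n ^ t\<close>.\<close>

lemma time_bound:
  fixes n t :: nat
  assumes "2 \<le> n"
  defines "V \<equiv> (n * n + 1) ^ t"
  shows "V * (400 * (t + 1) * (V + n * n + 1)) + 50 * t + 20 * n + 100 * (n * n + 1) \<le> n ^ (7 * t + 15)"
proof -
  have c: "c * n ^ k \<le> n ^ (j + k)" if "c \<le> 2 ^ j" for c j k
    using that assms(1) power_mono[of 2 n j] by (simp add: power_add)
  have "n * n + 1 \<le> 2 * n\<^sup>2" using assms(1) by (simp add: power2_eq_square)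
  also have "\<dots> \<le> n ^ 3" using c[of 2 1 2] by (simp add: power2_eq_square power3_eq_cube)
  finally have b: "n * n + 1 \<le> n ^ 3" .
  have V: "V \<le> n ^ (3 * t)" unfolding V_def power_mult by (rule power_mono[OF b]) simp
  have "t + 1 \<le> 2 ^ t" by (induction t) auto
  also have "\<dots> \<le> n ^ t" using assms(1) by (intro power_mono) auto
  finally have t: "t + 1 \<le> n ^ t" .
  have mono: "n ^ i \<le> n ^ j" if "i \<le> j" for i j using that assms(1) by (intro power_increasing) auto
  have "V + n * n + 1 \<le> 2 * n ^ (3 * t + 3)"
    using V b mono[of "3 * t" "3 * t + 3"] mono[of 3 "3 * t + 3"] by linarith
  also have "\<dots> \<le> n ^ (3 * t + 4)" using c[of 2 1 "3 * t + 3"] by (simp add: numeral_eq_Suc)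
  finally have s: "V + n * n + 1 \<le> n ^ (3 * t + 4)" .
  have "V * (400 * (t + 1) * (V + n * n + 1)) \<le> n ^ (3 * t) * (400 * n ^ t * n ^ (3 * t + 4))"
    using V t s by (intro mult_mono) auto
  also have "\<dots> = 400 * n ^ (7 * t + 4)" by (simp add: power_add[symmetric])
  also have "\<dots> \<le> n ^ (7 * t + 13)" using c[of 400 9 "7 * t + 4"] by (simp add: add_ac)
  finally have 1: "V * (400 * (t + 1) * (V + n * n + 1)) \<le> n ^ (7 * t + 13)" .
  have "50 * t \<le> 50 * n ^ t" using t by simp
  also have "\<dots> \<le> n ^ (7 * t + 13)" using c[of 50 6 t] mono[of "6 + t" "7 * t + 13"] by simp
  finally have 2: "50 * t \<le> n ^ (7 * t + 13)" .
  have 3: "20 * n \<le> n ^ (7 * t + 13)" using c[of 20 5 1] mono[of 6 "7 * t + 13"] by simp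
  have "100 * (n * n + 1) \<le> 100 * n ^ 3" using b by simp
  also have "\<dots> \<le> n ^ (7 * t + 13)" using c[of 100 7 3] mono[of 10 "7 * t + 13"] by simp
  finally have 4: "100 * (n * n + 1) \<le> n ^ (7 * t + 13)" .
  have "4 * n ^ (7 * t + 13) \<le> n ^ (7 * t + 15)" using c[of 4 2 "7 * t + 13"] by (simp add: numeral_eq_Suc)
  with 1 2 3 4 show ?thesis by linarith
qed

lemma rook_prog_computes:
  assumes "2 \<le> n" "0 < \<epsilon>" "\<epsilon> < 1"
  shows "computes_within rook_prog n R \<epsilon> (rook_approx (num_digits n \<epsilon>) n R)
    (real n powr (29 / ln 2 * (ln (real n) + ln (1 / \<epsilon>))))"
proof -
  define t where "t = num_digits n \<epsilon>"
  define V where "V = (n * n + 1) ^ t"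
  define \<Lambda> where "\<Lambda> = ln (real n) + ln (1 / \<epsilon>)"
  have "0 < n" using assms by simp
  from wp_rook_prog[OF this assms(2), of R] obtain T s where
    T: "exec rook_prog (input_state n R \<epsilon>) T s"
       "T \<le> V * (400 * (t + 1) * (V + n * n + 1)) + 50 * t + 20 * n + 100 * (n * n + 1)"
       "snd s 0 = rook_approx t n R"
    unfolding wp_def rook_approx_eq[OF \<open>0 < n\<close>] t_def V_def by blast
  have "ln 2 \<le> ln (real n)" using assms by (subst ln_le_cancel_iff) auto
  moreover have "0 \<le> ln (1 / \<epsilon>)" using assms by simp
  ultimately have "1 \<le> \<Lambda> / ln 2" by (simp add: \<Lambda>_def)
  moreover have "real t \<le> \<Lambda> / ln 2 + 1" using num_digits_le[OF assms] by (simp add: t_def \<Lambda>_def)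
  \<comment> \<open>29 = 7 + 7 + 15: the additive constants are multiplied by
    \<open>\<Lambda> / ln 2\<close>, which is at least 1.\<close>
  ultimately have "7 * real t + 15 \<le> 29 * (\<Lambda> / ln 2)" by linarith
  then have "real (7 * t + 15) \<le> 29 / ln 2 * \<Lambda>" by simp
  then have "real n powr real (7 * t + 15) \<le> real n powr (29 / ln 2 * \<Lambda>)"
    using assms by (intro powr_mono) auto
  moreover have "real T \<le> real (n ^ (7 * t + 15))"
    using T(2) time_bound[OF assms(1), of t] unfolding V_def by linarith
  moreover have "real (n ^ (7 * t + 15)) = real n powr real (7 * t + 15)"
    using assms(1) by (subst powr_realpow) auto
  ultimately have "real T \<le> real n powr (29 / ln 2 * \<Lambda>)" by linarith
  with T(1,3) show ?thesis unfolding computes_within_def t_def \<Lambda>_def by blast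
qed

section \<open>Truncation error and comparison with a product\<close>

lemma sum_power_div_fact_le_exp:
  fixes x :: real
  assumes "0 \<le> x" "finite K"
  shows "(\<Sum>k\<in>K. x ^ k / fact k) \<le> exp x"
proof -
  have "(\<lambda>k. x ^ k / fact k) sums exp x"
    using exp_converges[of x] by (simp add: divide_inverse mult.commute)
  then show ?thesis
    using assms sum_le_suminf[of "\<lambda>k. x ^ k / fact k" K] by (auto simp: sums_iff)
qed

text \<open>The square of the left-hand norm bound is compared with \<open>1 + x\<close>, the
  squared modulus of \<open>1 + u\<close>. Since \<open>\<bar>x\<bar> \<le> 1 / 2\<close>, the
  logarithm of \<open>1 + x\<close> is at least \<open>x - 2 * x\<^sup>2\<close>, and
  \<open>\<bar>x\<bar>\<close> is at most 11/5 times the modulus of \<open>u\<close>.\<close>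

lemma norm_one_plus_ge_exp:
  fixes u :: complex
  assumes "norm u \<le> 1 / 5"
  shows "exp (Re u - 5 * (norm u)\<^sup>2) \<le> norm (1 + u)"
proof -
  define x where "x = 2 * Re u + (norm u)\<^sup>2"
  have "\<bar>Re u\<bar> \<le> norm u" by (rule abs_Re_le_cmod)
  have sq: "(norm u)\<^sup>2 \<le> norm u / 5"
    using mult_left_mono[OF assms norm_ge_zero[of u]] by (simp add: power2_eq_square)
  have xb: "\<bar>x\<bar> \<le> 11 / 5 * norm u"
    using \<open>\<bar>Re u\<bar> \<le> norm u\<close> sq zero_le_power2[of "norm u"] unfolding x_def by linarith
  then have "\<bar>x\<bar> \<le> 1 / 2" using assms by linarith
  from abs_ln_one_plus_x_minus_x_bound[OF this] have "x - 2 * x\<^sup>2 \<le> ln (1 + x)" by linarith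
  moreover have "x\<^sup>2 \<le> 121 / 25 * (norm u)\<^sup>2"
    using power_mono[OF xb, of 2] by (simp add: power_mult_distrib power_divide)
  ultimately have "x - 242 / 25 * (norm u)\<^sup>2 \<le> ln (1 + x)" by linarith
  moreover have "2 * (Re u - 5 * (norm u)\<^sup>2) \<le> x - 242 / 25 * (norm u)\<^sup>2" by (simp add: x_def)
  ultimately have "2 * (Re u - 5 * (norm u)\<^sup>2) \<le> ln (1 + x)" by linarith
  then have "exp (2 * (Re u - 5 * (norm u)\<^sup>2)) \<le> 1 + x"
    using \<open>\<bar>x\<bar> \<le> 1 / 2\<close> by (subst (asm) ln_ge_iff) linarith+
  also have "1 + x = (norm (1 + u))\<^sup>2"
    unfolding x_def cmod_power2 by (simp add: power2_eq_square algebra_simps)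
  finally have "(exp (Re u - 5 * (norm u)\<^sup>2))\<^sup>2 \<le> (norm (1 + u))\<^sup>2" by (simp only: exp_double)
  then show ?thesis by (rule power2_le_imp_le) simp
qed

lemma norm_prod_one_plus_ge_exp:
  fixes u :: "'a \<Rightarrow> complex"
  assumes "\<And>s. s \<in> I \<Longrightarrow> norm (u s) \<le> 1 / 5"
  shows "exp (- norm (\<Sum>s\<in>I. u s) - 5 * (\<Sum>s\<in>I. (norm (u s))\<^sup>2)) \<le> norm (\<Prod>s\<in>I. 1 + u s)"
proof (cases "finite I")
  case True
  have "- norm (\<Sum>s\<in>I. u s) \<le> Re (\<Sum>s\<in>I. u s)"
    using abs_Re_le_cmod[of "\<Sum>s\<in>I. u s"] by linarith
  then have "exp (- norm (\<Sum>s\<in>I. u s) - 5 * (\<Sum>s\<in>I. (norm (u s))\<^sup>2))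
      \<le> exp (\<Sum>s\<in>I. Re (u s) - 5 * (norm (u s))\<^sup>2)"
    by (simp add: sum_subtractf sum_distrib_left)
  also have "\<dots> = (\<Prod>s\<in>I. exp (Re (u s) - 5 * (norm (u s))\<^sup>2))" by (rule exp_sum[OF True])
  also have "\<dots> \<le> (\<Prod>s\<in>I. norm (1 + u s))"
    by (intro prod_mono) (auto intro: norm_one_plus_ge_exp[OF assms])
  finally show ?thesis by (simp add: prod_norm)
qed auto

section \<open>Truncation error\<close>

definition rook_coeff :: "nat \<Rightarrow> cmatrix \<Rightarrow> nat \<Rightarrow> complex" where
  "rook_coeff n A l = fact (n - l) / fact n * (\<Sum>U\<in>rooks n l. \<Prod>s\<in>U. A s)"

text \<open>Each omitted term is re-expanded around \<mu> by \<open>sum_rooks_extensions\<close>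
  with shift \<open>- X / n\<close>. The result is a convolution of the sequence \<open>a\<close>
  with the exponential series \<open>b\<close>, and both carry powers of 2 so that
  \<open>(1 / 2) ^ k\<close> can be split off.\<close>

lemma norm_per_minus_rook_approx_le:
  fixes \<mu> :: complex and R :: cmatrix
  assumes "0 < n" "\<mu> \<noteq> 0"
  defines "A \<equiv> \<lambda>s. R s - \<mu>"
  defines "x \<equiv> norm ((\<Sum>s\<in>{..<n} \<times> {..<n}. A s) / of_nat n) / norm \<mu>"
  shows "norm (per n R - rook_approx t n R) \<le>
    fact n * norm \<mu> ^ n * ((1 / 2) ^ t * exp (3 * x) * (\<Sum>l\<le>n. (2 / norm \<mu>) ^ l * norm (rook_coeff n A l)))"
proof -
  define m where "m = matrix_mean n R"
  define X where "X = (\<Sum>s\<in>{..<n} \<times> {..<n}. A s) / of_nat n"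
  define a where "a = (\<lambda>l. (2 / norm \<mu>) ^ l * norm (rook_coeff n A l))"
  define b where "b = (\<lambda>j. (2 * x) ^ j / fact j)"
  have x: "0 \<le> x" by (simp add: x_def)
  have X: "norm X = x * norm \<mu>" using assms(2) by (simp add: x_def X_def)
  have m: "m = \<mu> + X / of_nat n"
    using assms(1) by (simp add: m_def matrix_mean_def X_def A_def sum_subtractf card_cartesian_product field_simps)
  define T where "T = (\<lambda>k. fact (n - k) * m ^ (n - k) * (\<Sum>S\<in>rooks n k. \<Prod>s\<in>S. R s - m))"
  have "norm m ^ (n - k) \<le> norm \<mu> ^ (n - k) * exp x" for k
  proof -
    have "norm m \<le> norm \<mu> * (1 + x / n)"
      unfolding m using norm_triangle_ineq[of \<mu> "X / of_nat n"] by (simp add: X norm_divide algebra_simps)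
    also have "\<dots> \<le> norm \<mu> * exp (x / n)" by (intro mult_left_mono) auto
    finally have "norm m ^ (n - k) \<le> (norm \<mu> * exp (x / n)) ^ (n - k)" by (rule power_mono) simp
    also have "\<dots> = norm \<mu> ^ (n - k) * exp (real (n - k) * (x / n))"
      by (simp add: power_mult_distrib exp_of_nat_mult[symmetric])
    also have "real (n - k) * (x / n) \<le> real n * (x / n)" using x by (intro mult_right_mono) auto
    finally show ?thesis using assms(1) by (simp add: mult_left_mono)
  qed
  note mk = this
  have T: "norm (T k) \<le> fact n * norm \<mu> ^ n * exp x * ((1 / 2) ^ k * (\<Sum>l\<le>k. a l * b (k - l)))" if k: "k \<le> n" for k
  proof -
    have "T k = m ^ (n - k) * (fact (n - k) * (\<Sum>S\<in>rooks n k. \<Prod>s\<in>S. A s + (- X / of_nat n)))"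
      by (simp add: T_def m A_def algebra_simps)
    also have "\<dots> = (\<Sum>l\<le>k. m ^ (n - k) * ((fact (n - l) * of_nat ((n - l) choose (k - l)) * (- X / of_nat n) ^ (k - l)) *
      (\<Sum>U\<in>rooks n l. \<Prod>s\<in>U. A s)))"
      unfolding sum_rooks_extensions[OF k] by (rule sum_distrib_left)
    finally have "norm (T k) \<le> (\<Sum>l\<le>k. norm (m ^ (n - k) * ((fact (n - l) * of_nat ((n - l) choose (k - l)) * (- X / of_nat n) ^ (k - l)) *
      (\<Sum>U\<in>rooks n l. \<Prod>s\<in>U. A s))))"
      by (simp only:) (rule norm_sum)
    also have "\<dots> \<le> (\<Sum>l\<le>k. fact n * norm \<mu> ^ n * exp x * ((1 / 2) ^ k * (a l * b (k - l))))"
    proof (rule sum_mono)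
      fix l assume l: "l \<in> {..k}"
      define e where "e = norm (rook_coeff n A l)"
      have e: "fact (n - l) * norm (\<Sum>U\<in>rooks n l. \<Prod>s\<in>U. A s) = fact n * e"
        by (simp add: e_def rook_coeff_def norm_mult norm_divide)
      \<comment> \<open>The power of \<open>n\<close> in this bound cancels the one in
        \<open>(X / n) ^ (k - l)\<close>, leaving a term of an exponential series.\<close>
      have "real ((n - l) choose (k - l)) * fact (k - l) \<le> real (n - l) ^ (k - l)"
        using binomial_fact_pow[of "n - l" "k - l"] by (metis of_nat_fact of_nat_le_iff of_nat_mult of_nat_power)
      also have "\<dots> \<le> real n ^ (k - l)" by (intro power_mono) auto
      finally have ch: "real ((n - l) choose (k - l)) \<le> real n ^ (k - l) / fact (k - l)"
        by (simp add: field_simps)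
      have "norm (m ^ (n - k) * ((fact (n - l) * of_nat ((n - l) choose (k - l)) * (- X / of_nat n) ^ (k - l)) *
          (\<Sum>U\<in>rooks n l. \<Prod>s\<in>U. A s))) =
        norm m ^ (n - k) * (real ((n - l) choose (k - l)) * (norm X / n) ^ (k - l) * (fact n * e))"
        unfolding e[symmetric] by (simp add: norm_mult norm_power norm_divide mult_ac)
      also have "\<dots> \<le> (norm \<mu> ^ (n - k) * exp x) * (real n ^ (k - l) / fact (k - l) * (norm X / n) ^ (k - l) * (fact n * e))"
        by (intro mult_mono mk ch mult_right_mono) (auto simp: e_def)
      also have "\<dots> = fact n * exp x * (norm \<mu> ^ (n - k) * norm \<mu> ^ (k - l)) * (x ^ (k - l) / fact (k - l)) * e"
        using assms(1) by (simp add: X power_mult_distrib power_divide)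
      also have "norm \<mu> ^ (n - k) * norm \<mu> ^ (k - l) = norm \<mu> ^ n / norm \<mu> ^ l"
        using assms(2) k l by (simp add: power_diff)
      also have "fact n * exp x * (norm \<mu> ^ n / norm \<mu> ^ l) * (x ^ (k - l) / fact (k - l)) * e =
          fact n * norm \<mu> ^ n * exp x * ((1 / 2) ^ k * (2 ^ l * 2 ^ (k - l)) * ((1 / norm \<mu> ^ l * e) * (x ^ (k - l) / fact (k - l))))"
        using l by (simp add: power_add[symmetric] power_one_over)
      also have "\<dots> = fact n * norm \<mu> ^ n * exp x * ((1 / 2) ^ k * (a l * b (k - l)))"
        by (simp add: a_def b_def e_def power_divide power_mult_distrib)
      finally show "norm (m ^ (n - k) * ((fact (n - l) * of_nat ((n - l) choose (k - l)) * (- X / of_nat n) ^ (k - l)) *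
          (\<Sum>U\<in>rooks n l. \<Prod>s\<in>U. A s))) \<le> fact n * norm \<mu> ^ n * exp x * ((1 / 2) ^ k * (a l * b (k - l)))" .
    qed
    finally show ?thesis by (simp only: sum_distrib_left)
  qed
  have a0: "0 \<le> a l" and b0: "0 \<le> b l" for l using x by (auto simp: a_def b_def)
  have "per n R = (\<Sum>k\<le>n. T k)" by (simp add: per_shift[of n R m] T_def)
  also have "\<dots> = (\<Sum>k\<in>{..n} \<inter> {..t}. T k) + (\<Sum>k\<in>{..n} - {..t}. T k)" by (rule sum.Int_Diff) simp
  \<comment> \<open>For \<open>k > n\<close> the sum over \<open>rooks n k\<close> is empty, so
    \<open>t\<close> may exceed \<open>n\<close>.\<close>
  also have "(\<Sum>k\<in>{..n} \<inter> {..t}. T k) = (\<Sum>k\<le>t. T k)"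
    by (rule sum.mono_neutral_left) (auto simp: T_def rooks_gt)
  also have "\<dots> = rook_approx t n R" by (simp add: rook_approx_def T_def m_def)
  finally have "norm (per n R - rook_approx t n R) = norm (\<Sum>k\<in>{..n} - {..t}. T k)" by simp
  also have "\<dots> \<le> (\<Sum>k\<in>{..n} - {..t}. norm (T k))" by (rule norm_sum)
  also have "\<dots> \<le> (\<Sum>k\<in>{..n} - {..t}. fact n * norm \<mu> ^ n * exp x * ((1 / 2) ^ t * (\<Sum>l\<le>k. a l * b (k - l))))"
  proof (rule sum_mono)
    fix k assume k: "k \<in> {..n} - {..t}"
    then have "norm (T k) \<le> fact n * norm \<mu> ^ n * exp x * ((1 / 2) ^ k * (\<Sum>l\<le>k. a l * b (k - l)))"
      by (intro T) simp
    also have "\<dots> \<le> fact n * norm \<mu> ^ n * exp x * ((1 / 2) ^ t * (\<Sum>l\<le>k. a l * b (k - l)))"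
      using k a0 b0 by (intro mult_left_mono mult_right_mono power_decreasing sum_nonneg) auto
    finally show "norm (T k) \<le> \<dots>" .
  qed
  also have "\<dots> = fact n * norm \<mu> ^ n * exp x * (1 / 2) ^ t * (\<Sum>k\<in>{..n} - {..t}. \<Sum>l\<le>k. a l * b (k - l))"
    by (simp add: sum_distrib_left mult_ac)
  also have "\<dots> \<le> fact n * norm \<mu> ^ n * exp x * (1 / 2) ^ t * ((\<Sum>l\<le>n. a l) * exp (2 * x))"
  proof (rule mult_left_mono)
    have "(\<Sum>k\<in>{..n} - {..t}. \<Sum>l\<le>k. a l * b (k - l)) \<le> (\<Sum>k\<le>n. \<Sum>l\<le>k. a l * b (k - l))"
      using a0 b0 by (intro sum_mono2 sum_nonneg) auto
    also have "\<dots> = (\<Sum>(l, j)\<in>{(l, j). l + j \<le> n}. a l * b j)"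
      by (rule sum.triangle_reindex_eq[symmetric])
    \<comment> \<open>Enlarging the triangle to a square makes the double sum factor.\<close>
    also have "\<dots> \<le> (\<Sum>(l, j)\<in>{..n} \<times> {..n}. a l * b j)"
      using a0 b0 by (intro sum_mono2) auto
    also have "\<dots> = (\<Sum>l\<le>n. a l) * (\<Sum>j\<le>n. b j)"
      by (simp add: sum_product sum.cartesian_product)
    also have "\<dots> \<le> (\<Sum>l\<le>n. a l) * exp (2 * x)"
      unfolding b_def using x a0 by (intro mult_left_mono sum_power_div_fact_le_exp sum_nonneg) auto
    finally show "(\<Sum>k\<in>{..n} - {..t}. \<Sum>l\<le>k. a l * b (k - l)) \<le> (\<Sum>l\<le>n. a l) * exp (2 * x)" .
  qed auto
  also have "\<dots> = fact n * norm \<mu> ^ n * ((1 / 2) ^ t * (exp x * exp (2 * x)) * (\<Sum>l\<le>n. a l))" by simp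
  also have "exp x * exp (2 * x) = exp (3 * x)" by (simp add: exp_add[symmetric])
  finally show ?thesis by (simp add: a_def)
qed


section \<open>Distance between the rook sum \<open>q\<close> and the product
  \<open>G\<close>\<close>

lemma per_eq_rook_coeff:
  fixes \<mu> :: complex
  assumes "\<mu> \<noteq> 0"
  shows "per n R = fact n * \<mu> ^ n * (\<Sum>l\<le>n. (1 / \<mu>) ^ l * rook_coeff n (\<lambda>s. R s - \<mu>) l)"
  unfolding per_shift[of n R \<mu>] sum_distrib_left rook_coeff_def
  using assms by (intro sum.cong refl) (simp add: power_diff power_one_over)

text \<open>The coefficient of \<open>\<chi>\<^sub>S\<close> in \<open>q - G\<close>.\<close>

definition dev_coeff :: "nat \<Rightarrow> complex \<Rightarrow> (nat \<times> nat) set \<Rightarrow> complex" where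
  "dev_coeff n z S = z ^ card S *
     ((if S \<in> rooks n (card S) then fact (n - card S) / fact n else 0) - 1 / of_nat n ^ card S)"

lemma rook_sum_minus_prod:
  fixes A :: cmatrix
  shows "(\<Sum>l\<le>n. z ^ l * rook_coeff n A l) - (\<Prod>s\<in>{..<n} \<times> {..<n}. 1 + z * A s / of_nat n) =
    (\<Sum>S\<in>Pow ({..<n} \<times> {..<n}). dev_coeff n z S * (\<Prod>s\<in>S. A s))"
proof -
  let ?I = "{..<n} \<times> {..<n}"
  have "(\<Prod>s\<in>?I. 1 + z * A s / of_nat n) = (\<Prod>s\<in>?I. z / of_nat n * A s + 1)"
    by (simp add: add.commute)
  also have "\<dots> = (\<Sum>S\<in>Pow ?I. (z / of_nat n) ^ card S * (\<Prod>s\<in>S. A s))"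
    by (subst prod_add) (simp_all add: prod.distrib del: times_divide_eq_left)
  finally have G: "(\<Prod>s\<in>?I. 1 + z * A s / of_nat n) = \<dots>" .
  have U: "{S \<in> Pow ?I. S \<in> rooks n (card S)} = (\<Union>l\<le>n. rooks n l)"
    using rooksD by (fastforce simp: Bex_def)
  have "(\<Sum>l\<le>n. z ^ l * rook_coeff n A l) =
      (\<Sum>l\<le>n. \<Sum>S\<in>rooks n l. z ^ card S * (fact (n - card S) / fact n) * (\<Prod>s\<in>S. A s))"
    unfolding rook_coeff_def sum_distrib_left
    by (intro sum.cong refl) (auto dest: rooksD(4))
  also have "\<dots> = (\<Sum>S\<in>(\<Union>l\<le>n. rooks n l). z ^ card S * (fact (n - card S) / fact n) * (\<Prod>s\<in>S. A s))"
    by (subst sum.UNION_disjoint) (auto dest: rooksD(4))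
  also have "\<dots> = (\<Sum>S\<in>Pow ?I. if S \<in> rooks n (card S) then z ^ card S * (fact (n - card S) / fact n) * (\<Prod>s\<in>S. A s) else 0)"
    unfolding U[symmetric] by (rule sum.inter_filter) simp
  finally have q: "(\<Sum>l\<le>n. z ^ l * rook_coeff n A l) = \<dots>" .
  show ?thesis
    unfolding q G sum_subtractf[symmetric] dev_coeff_def
    by (rule sum.cong) (auto simp: algebra_simps power_divide)
qed

text \<open>The right-hand side is the product of \<open>1 - i / n\<close> over
  \<open>i < k\<close>, which is at least 1 minus the sum of the \<open>i / n\<close>.\<close>

lemma falling_fact_ratio_ge:
  assumes "k \<le> n" "0 < n"
  shows "1 - real (k * (k - 1)) / (2 * n) \<le> fact n / (fact (n - k) * real n ^ k)"
  using assms(1)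
proof (induction k)
  case (Suc k)
  define c where "c = real (k * (k - 1)) / (2 * n)"
  have "(1 - c) * (1 - k / n) \<le> fact n / (fact (n - k) * real n ^ k) * (1 - k / n)"
    using Suc by (intro mult_right_mono) (auto simp: c_def)
  also have "fact (n - k) = (real n - real k) * fact (n - Suc k)"
    using Suc.prems by (simp add: fact_reduce[of "n - k"] of_nat_diff)
  also have "fact n / ((real n - real k) * fact (n - Suc k) * real n ^ k) * (1 - k / n) =
      fact n / (fact (n - Suc k) * real n ^ Suc k)"
    using Suc.prems by (simp add: field_simps)
  finally have "(1 - c) * (1 - k / n) \<le> fact n / (fact (n - Suc k) * real n ^ Suc k)" .
  moreover have "1 - real (Suc k * (Suc k - 1)) / (2 * n) = 1 - c - k / n"
    using assms(2) by (cases k) (simp_all add: c_def field_simps)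
  moreover have "(1 - c) * (1 - q) = 1 - c - q + c * q" for q by (simp add: algebra_simps)
  then have "(1 - c) * (1 - k / n) = 1 - c - k / n + c * (k / n)" .
  moreover have "0 \<le> c * (k / n)" by (simp add: c_def)
  ultimately show ?case by linarith
qed simp

lemma real_card_rooks:
  assumes "k \<le> n"
  shows "real (card (rooks n k)) = (fact n / fact (n - k))\<^sup>2 / fact k"
proof -
  have "real (card (rooks n k)) * (fact k * (fact (n - k))\<^sup>2) = (fact n)\<^sup>2"
    using arg_cong[OF card_rooks[OF assms], of real] by simp
  then show ?thesis by (simp add: field_simps power_divide)
qed

text \<open>Expanding the square gives three sums. For \<open>k \<le> n\<close> the rook weights
  contribute \<open>1 / fact k\<close>, the mixed term \<open>- 2 * p / fact k\<close>, and the
  product weights at most \<open>1 / fact k\<close>; then \<open>2 - 2 * p\<close> is bounded by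
  \<open>falling_fact_ratio_ge\<close>.\<close>

lemma sum_dev_coeff_card:
  assumes "0 < n"
  shows "(\<Sum>S | S \<subseteq> {..<n} \<times> {..<n} \<and> card S = k. (norm (dev_coeff n z S))\<^sup>2)
    \<le> ((norm z)\<^sup>2) ^ k * (real (k * (k - 1)) / (fact k * real n))"
proof -
  define I where "I = {..<n} \<times> {..<n}"
  define F where "F = {S. S \<subseteq> I \<and> card S = k}"
  define y where "y = ((norm z)\<^sup>2) ^ k"
  define w where "w = (fact (n - k) / fact n :: real)"
  define v where "v = 1 / real n ^ k"
  have y: "0 \<le> y" by (simp add: y_def)
  have [simp]: "finite I" "finite F" by (auto simp: I_def F_def)
  have RF: "rooks n k \<subseteq> F" by (auto simp: F_def I_def rooks_def)
  have "card F = (n * n) choose k"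
    unfolding F_def by (subst n_subsets) (auto simp: I_def card_cartesian_product)
  moreover define N where "N = real (n * n) ^ k"
  ultimately have "real (card F) * v\<^sup>2 = real ((n * n) choose k) / N"
    by (simp add: v_def power2_eq_square power_mult_distrib)
  moreover have "real ((n * n) choose k) * fact k \<le> N"
    using binomial_fact_pow[of "n * n" k] unfolding N_def
    by (metis of_nat_fact of_nat_le_iff of_nat_mult of_nat_power)
  moreover have "0 < N" using assms by (simp add: N_def)
  ultimately have "real (card F) * v\<^sup>2 = real ((n * n) choose k) / N"
      "real ((n * n) choose k) / N \<le> 1 / fact k"
    by (simp_all add: field_simps)
  then have cF: "real (card F) * v\<^sup>2 \<le> 1 / fact k" by simp
  have "(\<Sum>S\<in>F. (norm (dev_coeff n z S))\<^sup>2) = (\<Sum>S\<in>F. y * (if S \<in> rooks n k then w\<^sup>2 - 2 * w * v else 0) + y * v\<^sup>2)"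
  proof (rule sum.cong[OF refl])
    fix S assume "S \<in> F"
    then have S: "card S = k" by (simp add: F_def)
    have "dev_coeff n z S = z ^ k * of_real ((if S \<in> rooks n k then w else 0) - v)"
      by (simp add: dev_coeff_def S w_def v_def)
    then have "(norm (dev_coeff n z S))\<^sup>2 = y * ((if S \<in> rooks n k then w else 0) - v)\<^sup>2"
      by (simp only: norm_mult norm_power norm_of_real power_mult_distrib power2_abs)
         (simp add: y_def power_mult[symmetric] mult.commute)
    then show "(norm (dev_coeff n z S))\<^sup>2 = y * (if S \<in> rooks n k then w\<^sup>2 - 2 * w * v else 0) + y * v\<^sup>2"
      by (cases "S \<in> rooks n k") (simp_all add: power2_eq_square algebra_simps)
  qed
  also have "\<dots> = y * (real (card (rooks n k)) * (w\<^sup>2 - 2 * w * v) + real (card F) * v\<^sup>2)"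
    using RF by (simp add: sum.distrib sum_distrib_left[symmetric] sum.inter_restrict[symmetric] Int_absorb1 algebra_simps)
  also have "\<dots> \<le> y * (real (k * (k - 1)) / (fact k * real n))"
  proof (rule mult_left_mono[OF _ y])
    show "real (card (rooks n k)) * (w\<^sup>2 - 2 * w * v) + real (card F) * v\<^sup>2 \<le> real (k * (k - 1)) / (fact k * real n)"
    proof (cases "k \<le> n")
      case True
      define p where "p = fact n / (fact (n - k) * real n ^ k)"
      have "real (card (rooks n k)) * (w\<^sup>2 - 2 * w * v) = (1 - 2 * p) / fact k"
        unfolding real_card_rooks[OF True] w_def v_def p_def
        by (simp add: field_simps power2_eq_square)
      moreover have "(1 - 2 * p) / fact k + 1 / fact k = (2 - 2 * p) / fact k" by (simp add: field_simps)
      moreover have "(2 - 2 * p) / fact k \<le> (real (k * (k - 1)) / n) / fact k"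
      proof (rule divide_right_mono)
        have "real (k * (k - 1)) / (2 * n) = (real (k * (k - 1)) / n) / 2" by (simp del: of_nat_mult)
        then show "2 - 2 * p \<le> real (k * (k - 1)) / n"
          using falling_fact_ratio_ge[OF True assms] unfolding p_def[symmetric] by linarith
      qed simp
      moreover have "real (k * (k - 1)) / n / fact k = real (k * (k - 1)) / (fact k * real n)" by simp
      ultimately show ?thesis using cF by linarith
    next
      case False
      \<comment> \<open>Without rook placements only the product weights remain; they are small
        enough because \<open>k * (k - 1) \<ge> n\<close>.\<close>
      then have "n \<le> k - 1" "1 \<le> k" using assms by auto
      then have "1 * n \<le> k * (k - 1)" by (rule mult_le_mono[rotated])
      then have "1 \<le> real (k * (k - 1)) / n" using assms by (simp add: le_divide_eq del: of_nat_mult)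
      then have "1 / fact k \<le> real (k * (k - 1)) / n / fact k" by (rule divide_right_mono) simp
      then show ?thesis using cF False by (simp add: rooks_gt mult.commute)
    qed
  qed
  finally show ?thesis by (simp add: F_def I_def y_def)
qed

text \<open>Summing over sizes, \<open>k * (k - 1)\<close> cancels two factors of
  \<open>fact k\<close>, so an exponential series shifted by two remains.\<close>

lemma sum_dev_coeff:
  assumes "0 < n"
  shows "(\<Sum>S\<in>Pow ({..<n} \<times> {..<n}). (norm (dev_coeff n z S))\<^sup>2) \<le> norm z ^ 4 * exp ((norm z)\<^sup>2) / n"
proof -
  define I where "I = {..<n} \<times> {..<n}"
  define y where "y = (norm z)\<^sup>2"
  define f where "f = (\<lambda>k. y ^ k * (real (k * (k - 1)) / (fact k * real n)))"
  have f: "f 0 = 0" "f (Suc 0) = 0" by (simp_all add: f_def)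
  have [simp]: "finite I" by (simp add: I_def)
  have U: "Pow I = (\<Union>k\<le>card I. {S. S \<subseteq> I \<and> card S = k})"
    using card_mono[OF \<open>finite I\<close>] by auto
  have "(\<Sum>S\<in>Pow I. (norm (dev_coeff n z S))\<^sup>2) =
      (\<Sum>k\<le>card I. \<Sum>S | S \<subseteq> I \<and> card S = k. (norm (dev_coeff n z S))\<^sup>2)"
    unfolding U by (subst sum.UNION_disjoint) auto
  also have "\<dots> \<le> (\<Sum>k\<le>card I. y ^ k * (real (k * (k - 1)) / (fact k * real n)))"
    unfolding I_def y_def by (intro sum_mono sum_dev_coeff_card[OF assms])
  also have "\<dots> = (\<Sum>k\<le>card I. f k)" by (simp add: f_def)
  \<comment> \<open>Two nonnegative terms are added so that dropping \<open>k = 0\<close> and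
    \<open>k = 1\<close> leaves a clean index shift.\<close>
  also have "\<dots> \<le> (\<Sum>k\<le>card I + 2. f k)"
    by (intro sum_mono2) (auto simp: f_def y_def)
  also have "\<dots> = (\<Sum>k\<le>card I. f (k + 2))"
    using f by (simp add: sum.atMost_Suc_shift del: sum.atMost_Suc)
  also have "\<dots> = (\<Sum>k\<le>card I. y ^ 2 / n * (y ^ k / fact k))"
  proof (rule sum.cong[OF refl])
    fix k
    define c where "c = real ((k + 2) * (k + 1))"
    have "c \<noteq> 0" by (simp add: c_def del: of_nat_mult)
    moreover have "fact (k + 2) = c * fact k" by (simp add: c_def algebra_simps)
    moreover have "k + 2 - 1 = k + 1" by simp
    then have "f (k + 2) = y ^ (k + 2) * (c / (fact (k + 2) * real n))" by (simp only: f_def c_def)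
    ultimately have "c \<noteq> 0" "f (k + 2) = y ^ (k + 2) * (c / (c * fact k * real n))" by (simp_all only: not_False_eq_True)
    then show "f (k + 2) = y ^ 2 / n * (y ^ k / fact k)" by (simp add: power_add power2_eq_square mult_ac)
  qed
  also have "\<dots> = y ^ 2 / n * (\<Sum>k\<le>card I. y ^ k / fact k)" by (rule sum_distrib_left[symmetric])
  also have "\<dots> \<le> y ^ 2 / n * exp y"
    by (intro mult_left_mono sum_power_div_fact_le_exp) (auto simp: y_def)
  finally show ?thesis by (simp add: I_def y_def power_mult[symmetric])
qed

section \<open>Random matrices\<close>

locale random_matrix =
  fixes n :: nat and \<mu> :: complex and \<rho> :: real and D :: "complex measure"
  assumes entry: "entry_distribution \<mu> \<rho> D" and n_pos: "0 < n"
begin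

abbreviation "cells \<equiv> {..<n} \<times> {..<n}"
abbreviation "M \<equiv> iid_matrix n D"

sublocale D: prob_space D
  using entry by (simp add: entry_distribution_def)

sublocale P: product_prob_space "\<lambda>_. D" cells ..

sublocale M: prob_space M
  unfolding iid_matrix_def by (rule prob_space_PiM) (rule D.prob_space_axioms)

lemma sets_D [measurable_cong]: "sets D = sets borel"
  using entry by (simp add: entry_distribution_def)

lemma integrable_cube: "integrable D (\<lambda>x. norm (x - \<mu>) ^ 3)"
  and mean: "(LINT x|D. x) = \<mu>"
  and variance: "(LINT x|D. norm (x - \<mu>) ^ 2) = 1"
  and third_moment: "(LINT x|D. norm (x - \<mu>) ^ 3) = \<rho>"
  using entry by (simp_all add: entry_distribution_def)

text \<open>Supplies the dominating function by which the lower moments inherit integrability from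
  the third.\<close>

lemma power_le_one_plus_cube: "0 \<le> a \<Longrightarrow> k \<le> 3 \<Longrightarrow> a ^ k \<le> 1 + a ^ 3" for a :: real
  by (cases "a \<le> 1") (auto intro: power_le_one[THEN order_trans] power_increasing[THEN order_trans])

lemma integrable_square: "integrable D (\<lambda>x. norm (x - \<mu>) ^ 2)"
proof (rule Bochner_Integration.integrable_bound)
  show "integrable D (\<lambda>x. 1 + norm (x - \<mu>) ^ 3)" using integrable_cube by simp
qed (use power_le_one_plus_cube[of _ 2] in auto)

lemma integrable_centered: "integrable D (\<lambda>x. x - \<mu>)"
proof (rule Bochner_Integration.integrable_bound)
  show "integrable D (\<lambda>x. 1 + norm (x - \<mu>) ^ 3)" using integrable_cube by simp
qed (use power_le_one_plus_cube[of _ 1] in auto)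

lemma integral_centered: "(LINT x|D. x - \<mu>) = 0"
proof -
  have "integrable D (\<lambda>x. (x - \<mu>) + \<mu>)" by (intro Bochner_Integration.integrable_add integrable_centered) simp
  then have "integrable D (\<lambda>x. x)" by simp
  then show ?thesis by (simp add: mean D.prob_space)
qed

section \<open>Orthonormal monomials and moments\<close>

definition chi :: "(nat \<times> nat) set \<Rightarrow> cmatrix \<Rightarrow> complex" where
  "chi S R = (\<Prod>s\<in>S. R s - \<mu>)"

lemma entry_measurable [measurable]: "s \<in> cells \<Longrightarrow> (\<lambda>R. R s) \<in> borel_measurable M"
proof -
  assume "s \<in> cells"
  then have "(\<lambda>R. R s) \<in> measurable M D"
    unfolding iid_matrix_def by (rule measurable_component_singleton)
  then show ?thesis using measurable_cong_sets[OF refl sets_D] by blast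
qed

text \<open>By independence the expectation factors over cells. A cell in both sets contributes the
  variance 1, a cell in exactly one contributes the mean 0 of a centred entry, and any other cell
  contributes 1.\<close>

lemma chi_orthonormal:
  assumes "S \<subseteq> cells" "T \<subseteq> cells"
  shows "integrable M (\<lambda>R. chi S R * cnj (chi T R))"
    and "(LINT R|M. chi S R * cnj (chi T R)) = of_bool (S = T)"
proof -
  define f where "f = (\<lambda>s x. (if s \<in> S then x - \<mu> else 1) * (if s \<in> T then cnj (x - \<mu>) else 1))"
  have eq: "chi S R * cnj (chi T R) = (\<Prod>s\<in>cells. f s (R s))" for R
  proof -
    have "(\<Prod>s\<in>cells. if s \<in> S then R s - \<mu> else 1) = chi S R"
      using assms(1) by (simp add: chi_def prod.inter_restrict[symmetric] Int_absorb1)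
    moreover have "(\<Prod>s\<in>cells. if s \<in> T then cnj (R s - \<mu>) else 1) = cnj (chi T R)"
      using assms(2) by (simp add: chi_def prod.inter_restrict[symmetric] Int_absorb1 del: complex_cnj_diff)
    ultimately show ?thesis by (simp add: f_def prod.distrib)
  qed
  have sq: "(x - \<mu>) * cnj (x - \<mu>) = of_real (norm (x - \<mu>) ^ 2)" for x
    by (rule complex_norm_square[symmetric])
  have cross: "integrable D (\<lambda>x. (x - \<mu>) * cnj (x - \<mu>))" "(LINT x|D. (x - \<mu>) * cnj (x - \<mu>)) = 1"
    unfolding sq using integrable_square variance
    by (simp_all only: integrable_of_real integral_complex_of_real of_real_1)
  have conj: "integrable D (\<lambda>x. cnj (x - \<mu>))" "(LINT x|D. cnj (x - \<mu>)) = 0"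
    using integrable_centered integral_centered by (simp_all del: complex_cnj_diff)
  have int: "integrable D (f s)" for s
    unfolding f_def by (cases "s \<in> S"; cases "s \<in> T")
      (simp_all add: integrable_centered cross conj del: complex_cnj_diff)
  show "integrable M (\<lambda>R. chi S R * cnj (chi T R))"
    unfolding eq iid_matrix_def by (rule P.product_integrable_prod) (auto simp: int)
  have "(LINT R|M. chi S R * cnj (chi T R)) = (\<Prod>s\<in>cells. LINT x|D. f s x)"
    unfolding eq iid_matrix_def by (rule P.product_integral_prod) (auto simp: int)
  also have "\<dots> = (\<Prod>s\<in>cells. of_bool (s \<in> S \<longleftrightarrow> s \<in> T))"
    by (intro prod.cong refl)
       (auto simp: f_def integral_centered cross conj D.prob_space simp del: complex_cnj_diff)
  also have "\<dots> = of_bool (S = T)"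
  proof (cases "S = T")
    case False
    then obtain s where "s \<in> cells" "(s \<in> S) \<noteq> (s \<in> T)" using assms by blast
    then have "(\<Prod>s\<in>cells. of_bool ((s \<in> S) = (s \<in> T))) = (0 :: complex)"
      by (intro prod_zero) auto
    then show ?thesis using False by simp
  qed auto
  finally show "(LINT R|M. chi S R * cnj (chi T R)) = of_bool (S = T)" .
qed

lemma chi_parseval:
  assumes "F \<subseteq> Pow cells"
  shows "integrable M (\<lambda>R. (norm (\<Sum>S\<in>F. a S * chi S R))\<^sup>2)"
    and "(LINT R|M. (norm (\<Sum>S\<in>F. a S * chi S R))\<^sup>2) = (\<Sum>S\<in>F. (norm (a S))\<^sup>2)"
proof -
  have fin: "finite F" by (rule finite_subset[OF assms]) simp
  define g where "g = (\<lambda>R. \<Sum>S\<in>F. \<Sum>T\<in>F. (a S * cnj (a T)) * (chi S R * cnj (chi T R)))"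
  have eq: "(norm (\<Sum>S\<in>F. a S * chi S R))\<^sup>2 = Re (g R)" for R
  proof -
    have "g R = (\<Sum>S\<in>F. a S * chi S R) * cnj (\<Sum>S\<in>F. a S * chi S R)"
      by (simp add: g_def sum_product mult_ac)
    also have "\<dots> = complex_of_real ((norm (\<Sum>S\<in>F. a S * chi S R))\<^sup>2)"
      by (rule complex_norm_square[symmetric])
    finally show ?thesis by (simp only: Re_complex_of_real)
  qed
  have int: "integrable M (\<lambda>R. (a S * cnj (a T)) * (chi S R * cnj (chi T R)))" if "S \<in> F" "T \<in> F" for S T
    using that assms by (intro integrable_mult_right chi_orthonormal) auto
  then have g: "integrable M g" unfolding g_def by (intro Bochner_Integration.integrable_sum)
  then show "integrable M (\<lambda>R. (norm (\<Sum>S\<in>F. a S * chi S R))\<^sup>2)" unfolding eq by simp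
  have "(LINT R|M. g R) = (\<Sum>S\<in>F. \<Sum>T\<in>F. (a S * cnj (a T)) * of_bool (S = T))"
    unfolding g_def using int assms
    by (subst Bochner_Integration.integral_sum, force intro!: Bochner_Integration.integrable_sum)
       (auto intro!: sum.cong simp: Bochner_Integration.integral_sum chi_orthonormal subset_iff)
  also have "\<dots> = (\<Sum>S\<in>F. of_real ((norm (a S))\<^sup>2))"
    using fin unfolding complex_norm_square by (simp add: of_bool_def if_distrib cong: if_cong)
  finally show "(LINT R|M. (norm (\<Sum>S\<in>F. a S * chi S R))\<^sup>2) = (\<Sum>S\<in>F. (norm (a S))\<^sup>2)"
    unfolding eq using g by (simp flip: of_real_sum)
qed

text \<open>The product formula again, with the constant factor 1 on all other cells.\<close>

lemma coordinate:
  fixes f :: "complex \<Rightarrow> real"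
  assumes "s \<in> cells" "integrable D f"
  shows "integrable M (\<lambda>R. f (R s))" "(LINT R|M. f (R s)) = (LINT x|D. f x)"
proof -
  define g where "g = (\<lambda>t. if t = s then f else (\<lambda>_. 1))"
  have eq: "f (R s) = (\<Prod>t\<in>cells. g t (R t))" for R
  proof -
    have "(\<Prod>t\<in>cells. g t (R t)) = (\<Prod>t\<in>cells. if t = s then f (R t) else 1)"
      by (intro prod.cong) (auto simp: g_def)
    then show ?thesis using assms(1) by simp
  qed
  have int: "integrable D (g t)" for t using assms(2) by (simp add: g_def)
  show "integrable M (\<lambda>R. f (R s))"
    unfolding eq iid_matrix_def by (rule P.product_integrable_prod) (auto simp: int)
  have "(LINT R|M. f (R s)) = (\<Prod>t\<in>cells. LINT x|D. g t x)"
    unfolding eq iid_matrix_def by (rule P.product_integral_prod) (auto simp: int)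
  also have "\<dots> = (\<Prod>t\<in>cells. if t = s then LINT x|D. f x else 1)"
    by (intro prod.cong) (auto simp: g_def D.prob_space)
  finally show "(LINT R|M. f (R s)) = (LINT x|D. f x)" using assms(1) by simp
qed

lemma markov:
  fixes u :: "cmatrix \<Rightarrow> real"
  assumes "integrable M u" "\<And>R. 0 \<le> u R" "(LINT R|M. u R) \<le> b" "0 < c"
  shows "measure M {R \<in> space M. u R \<ge> c} \<le> b / c"
proof -
  have "measure M {R \<in> space M. u R \<ge> c} \<le> (LINT R|M. u R) / c"
    using assms by (intro integral_Markov_inequality_measure[where A = "{}"]) auto
  also have "\<dots> \<le> b / c" using assms by (intro divide_right_mono) auto
  finally show ?thesis .
qed

end

section \<open>Accuracy on the good event\<close>

text \<open>The deterministic half: five statistics below their thresholds force accuracy. The first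
  four give \<open>\<eta> \<le> norm q\<close> through the product \<open>G\<close>; the first and
  the last bound the truncation error by \<open>\<epsilon>\<close> times that lower bound, up to the
  common factor \<open>K\<close>.\<close>

lemma rook_approx_accurate:
  fixes \<mu> :: complex and R :: cmatrix and n :: nat
  defines "A \<equiv> \<lambda>s. R s - \<mu>" and "z \<equiv> 1 / \<mu>"
  defines "cells \<equiv> {..<n} \<times> {..<n}"
  assumes "0 < n" "\<mu> \<noteq> 0" "norm z \<le> \<kappa>" "0 < \<kappa>" "0 \<le> L"
    and mean: "(norm ((\<Sum>s\<in>cells. A s) / of_nat n))\<^sup>2 < L"
    and square: "(\<Sum>s\<in>cells. norm (A s) ^ 2) < L * real n ^ 2"
    and cube: "(\<Sum>s\<in>cells. norm (A s) ^ 3) < (n / (5 * \<kappa>)) ^ 3"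
    and dev: "(norm (\<Sum>S\<in>Pow cells. dev_coeff n z S * (\<Prod>s\<in>S. A s)))\<^sup>2 < L * (\<kappa> ^ 4 * exp (\<kappa>\<^sup>2) / n)"
    and coeffs: "(\<Sum>l\<le>n. 8 ^ l * ((norm z)\<^sup>2) ^ l * (norm (rook_coeff n A l))\<^sup>2) < L * exp (8 * \<kappa>\<^sup>2)"
    and \<eta>: "\<eta> \<le> exp (- \<kappa> * sqrt L - 5 * \<kappa>\<^sup>2 * L) - sqrt (L * (\<kappa> ^ 4 * exp (\<kappa>\<^sup>2) / n))" "0 < \<eta>"
      "exp (3 * \<kappa> * sqrt L) * sqrt (2 * (L * exp (8 * \<kappa>\<^sup>2))) / n \<le> \<eta>"
    and t: "0 < \<epsilon>" "real n \<le> 2 ^ t * \<epsilon>"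
  shows "norm (1 - rook_approx t n R / per n R) \<le> \<epsilon>"
proof -
  define q where "q = (\<Sum>l\<le>n. z ^ l * rook_coeff n A l)"
  define G where "G = (\<Prod>s\<in>cells. 1 + z * A s / of_nat n)"
  define X where "X = (\<Sum>s\<in>cells. A s) / of_nat n"
  define x where "x = norm X / norm \<mu>"
  define H where "H = (\<Sum>l\<le>n. (2 / norm \<mu>) ^ l * norm (rook_coeff n A l))"
  define K where "K = fact n * norm \<mu> ^ n"
  have z: "norm z = 1 / norm \<mu>" by (simp add: z_def norm_divide)
  have K: "0 < K" using assms by (simp add: K_def)
  have X: "norm X \<le> sqrt L" using mean unfolding X_def by (intro real_le_rsqrt) simp
  have x: "x \<le> \<kappa> * sqrt L"
  proof -
    have "x = norm z * norm X" by (simp add: x_def z)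
    also have "\<dots> \<le> \<kappa> * sqrt L" using X assms by (intro mult_mono) auto
    finally show ?thesis .
  qed

  have "norm (q - G) \<le> sqrt (L * (\<kappa> ^ 4 * exp (\<kappa>\<^sup>2) / n))"
    unfolding q_def G_def cells_def rook_sum_minus_prod
    using dev unfolding cells_def by (intro real_le_rsqrt) simp
  moreover have "exp (- \<kappa> * sqrt L - 5 * \<kappa>\<^sup>2 * L) \<le> norm G"
  proof -
    \<comment> \<open>A single cube is at most the sum of all cubes, so the third-moment bound makes
      every factor of \<open>G\<close> close enough to 1.\<close>
    have small: "norm (z * A s / of_nat n) \<le> 1 / 5" if "s \<in> cells" for s
    proof -
      have "norm (A s) ^ 3 \<le> (\<Sum>s\<in>cells. norm (A s) ^ 3)"
        using that by (intro member_le_sum) (auto simp: cells_def)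
      with cube have "norm (A s) ^ 3 \<le> (n / (5 * \<kappa>)) ^ 3" by simp
      then have "norm (A s) \<le> n / (5 * \<kappa>)"
        using assms by (subst (asm) power_mono_iff) auto
      then have "norm z * norm (A s) \<le> \<kappa> * (n / (5 * \<kappa>))" using assms by (intro mult_mono) auto
      then show ?thesis using assms by (simp add: norm_mult norm_divide field_simps)
    qed
    have "(\<Sum>s\<in>cells. (norm (z * A s / of_nat n))\<^sup>2) = (norm z)\<^sup>2 * ((\<Sum>s\<in>cells. norm (A s) ^ 2) / real n ^ 2)"
      by (simp add: norm_mult norm_divide power_mult_distrib power_divide sum_divide_distrib sum_distrib_left)
    also have "\<dots> \<le> \<kappa>\<^sup>2 * L"
      using assms square by (intro mult_mono power_mono) (auto simp: field_simps intro!: divide_nonneg_nonneg sum_nonneg)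
    finally have s2: "(\<Sum>s\<in>cells. (norm (z * A s / of_nat n))\<^sup>2) \<le> \<kappa>\<^sup>2 * L" .
    have "(\<Sum>s\<in>cells. z * A s / of_nat n) = z * X" by (simp add: X_def sum_distrib_left sum_divide_distrib)
    then have "norm (\<Sum>s\<in>cells. z * A s / of_nat n) = x" by (simp add: norm_mult z x_def)
    with x s2 have "- \<kappa> * sqrt L - 5 * \<kappa>\<^sup>2 * L
        \<le> - norm (\<Sum>s\<in>cells. z * A s / of_nat n) - 5 * (\<Sum>s\<in>cells. (norm (z * A s / of_nat n))\<^sup>2)" by simp
    also have "exp \<dots> \<le> norm G" unfolding G_def by (rule norm_prod_one_plus_ge_exp[OF small])
    finally show ?thesis by simp
  qed
  moreover have "norm G \<le> norm q + norm (q - G)"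
    using norm_triangle_ineq4[of q "q - G"] by simp
  ultimately have "\<eta> \<le> norm q" using \<eta>(1) by linarith
  moreover have "norm (per n R) = K * norm q"
    unfolding per_eq_rook_coeff[OF assms(5), of n R] by (simp add: K_def q_def z_def A_def norm_mult norm_power)
  ultimately have per: "K * \<eta> \<le> norm (per n R)" using K by simp

  \<comment> \<open>Cauchy-Schwarz with weights \<open>(1 / 2) ^ l\<close>, whose sum is at most 2;
    the base 8 is the square of 2 times the 2 lost to the weights.\<close>
  have "H\<^sup>2 \<le> 2 * (\<Sum>l\<le>n. 8 ^ l * ((norm z)\<^sup>2) ^ l * (norm (rook_coeff n A l))\<^sup>2)"
  proof -
    define g where "g = (\<lambda>l. 8 ^ l * ((norm z)\<^sup>2) ^ l * (norm (rook_coeff n A l))\<^sup>2)"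
    have "H = (\<Sum>l\<le>n. sqrt ((1 / 2) ^ l) * sqrt (g l))"
      unfolding H_def
    proof (rule sum.cong[OF refl])
      fix l
      have "(1 / 2) ^ l * g l = (1 / 2 * 8 * (norm z)\<^sup>2) ^ l * (norm (rook_coeff n A l))\<^sup>2"
        by (simp only: g_def power_mult_distrib mult.assoc)
      also have "1 / 2 * 8 * (norm z)\<^sup>2 = (2 / norm \<mu>)\<^sup>2" by (simp add: z power_divide)
      also have "((2 / norm \<mu>)\<^sup>2) ^ l = ((2 / norm \<mu>) ^ l)\<^sup>2" by (metis power_mult mult.commute)
      also have "\<dots> * (norm (rook_coeff n A l))\<^sup>2 = ((2 / norm \<mu>) ^ l * norm (rook_coeff n A l))\<^sup>2"
        by (rule power_mult_distrib[symmetric])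
      finally have "(1 / 2) ^ l * g l = ((2 / norm \<mu>) ^ l * norm (rook_coeff n A l))\<^sup>2" .
      then show "(2 / norm \<mu>) ^ l * norm (rook_coeff n A l) = sqrt ((1 / 2) ^ l) * sqrt (g l)"
        by (simp add: real_sqrt_mult[symmetric])
    qed
    then have "H\<^sup>2 \<le> (\<Sum>l\<le>n. (sqrt ((1 / 2) ^ l))\<^sup>2) * (\<Sum>l\<le>n. (sqrt (g l))\<^sup>2)"
      by (simp only: Cauchy_Schwarz_ineq_sum)
    also have "(\<Sum>l\<le>n. (sqrt (g l))\<^sup>2) = (\<Sum>l\<le>n. g l)"
      by (intro sum.cong refl real_sqrt_pow2) (simp add: g_def)
    also have "(\<Sum>l\<le>n. (sqrt ((1 / 2) ^ l))\<^sup>2) = (\<Sum>l\<le>n. (1 / 2 :: real) ^ l)" by simp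
    also have "\<dots> \<le> 2"
      using sum_le_suminf[OF summable_geometric[of "1 / 2 :: real"], of "{..n}"] suminf_geometric[of "1 / 2 :: real"] by simp
    finally show ?thesis by (simp add: g_def mult_right_mono sum_nonneg)
  qed
  with coeffs have "H\<^sup>2 \<le> 2 * (L * exp (8 * \<kappa>\<^sup>2))" by linarith
  then have H: "H \<le> sqrt (2 * (L * exp (8 * \<kappa>\<^sup>2)))" by (rule real_le_rsqrt)
  have "(1 / 2) ^ t \<le> \<epsilon> / n" using t assms(4) by (simp add: field_simps power_one_over)
  have "norm (per n R - rook_approx t n R) \<le> K * ((1 / 2) ^ t * exp (3 * x) * H)"
    using norm_per_minus_rook_approx_le[OF assms(4,5), of R t]
    by (simp add: K_def H_def x_def X_def A_def cells_def)
  also have "\<dots> \<le> K * ((\<epsilon> / n) * exp (3 * (\<kappa> * sqrt L)) * sqrt (2 * (L * exp (8 * \<kappa>\<^sup>2))))"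
    using K H x \<open>(1 / 2) ^ t \<le> \<epsilon> / n\<close> t
    by (intro mult_left_mono mult_mono) (auto simp: H_def intro!: sum_nonneg)
  also have "\<dots> = \<epsilon> * K * (exp (3 * \<kappa> * sqrt L) * sqrt (2 * (L * exp (8 * \<kappa>\<^sup>2))) / n)" by (simp add: mult_ac)
  also have "\<dots> \<le> \<epsilon> * K * \<eta>" using \<eta>(3) K t by (intro mult_left_mono) auto
  also have "\<dots> \<le> \<epsilon> * norm (per n R)" using per t by simp
  finally have "norm (per n R - rook_approx t n R) \<le> \<epsilon> * norm (per n R)" .
  \<comment> \<open>Nonvanishing has to be shown, since division by 0 would give 0 and the ratio
    would be meaningless.\<close>
  moreover have "0 < norm (per n R)" using per K \<eta>(2) by (meson less_le_trans mult_pos_pos)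
  ultimately have "norm ((per n R - rook_approx t n R) / per n R) \<le> \<epsilon>"
    by (simp add: norm_divide divide_le_eq)
  also have "(per n R - rook_approx t n R) / per n R = 1 - rook_approx t n R / per n R"
    using \<open>0 < norm (per n R)\<close> by (simp add: diff_divide_distrib)
  finally show ?thesis .
qed

section \<open>Probability of the good event\<close>

context random_matrix
begin

lemma measurable_prod_cells [measurable]:
  assumes "S \<subseteq> cells" "f \<in> borel_measurable M"
  shows "(\<lambda>R. \<Prod>s\<in>S. R s - f R) \<in> borel_measurable M"
  using assms by (intro borel_measurable_prod borel_measurable_diff entry_measurable) auto

lemma measurable_per [measurable]: "per n \<in> borel_measurable M"
proof -
  have "(\<lambda>R. \<Sum>S\<in>rooks n n. \<Prod>s\<in>S. R s - 0) \<in> borel_measurable M"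
    by (intro borel_measurable_sum measurable_prod_cells rooksD(1)) auto
  then show ?thesis by (simp add: per_eq_sum_rooks[abs_def])
qed

lemma measurable_rook_approx [measurable]: "rook_approx t n \<in> borel_measurable M"
proof -
  have [measurable]: "matrix_mean n \<in> borel_measurable M"
    unfolding matrix_mean_def[abs_def] by measurable
  show ?thesis
    unfolding rook_approx_def[abs_def]
    by (intro borel_measurable_sum borel_measurable_times borel_measurable_power measurable_prod_cells rooksD(1))
       auto
qed

lemma rook_coeff_chi: "rook_coeff n (\<lambda>s. R s - \<mu>) l = (\<Sum>S\<in>rooks n l. (fact (n - l) / fact n) * chi S R)"
  by (simp add: rook_coeff_def chi_def sum_distrib_left)

text \<open>Parseval with equal coefficients: the number of placements times the squared weight is
  \<open>1 / fact l\<close>.\<close>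

lemma rook_coeff_second_moment:
  assumes "l \<le> n"
  shows "integrable M (\<lambda>R. (norm (rook_coeff n (\<lambda>s. R s - \<mu>) l))\<^sup>2)"
    and "(LINT R|M. (norm (rook_coeff n (\<lambda>s. R s - \<mu>) l))\<^sup>2) = 1 / fact l"
proof -
  have F: "rooks n l \<subseteq> Pow cells" using rooksD(1) by blast
  show "integrable M (\<lambda>R. (norm (rook_coeff n (\<lambda>s. R s - \<mu>) l))\<^sup>2)"
    unfolding rook_coeff_chi by (rule chi_parseval(1)[OF F])
  show "(LINT R|M. (norm (rook_coeff n (\<lambda>s. R s - \<mu>) l))\<^sup>2) = 1 / fact l"
    unfolding rook_coeff_chi chi_parseval(2)[OF F]
    by (simp add: norm_divide real_card_rooks[OF assms] field_simps)
qed

text \<open>A union bound over five Markov inequalities. Four thresholds are \<open>L\<close> times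
  a bound on the expectation and cost \<open>1 / L\<close> each; the cubes cost the term with
  \<rho>.\<close>

lemma rook_approx_accurate_prob:
  assumes "\<mu> \<noteq> 0" "1 / norm \<mu> \<le> \<kappa>" "0 < \<kappa>" "0 < L"
    and \<eta>: "\<eta> \<le> exp (- \<kappa> * sqrt L - 5 * \<kappa>\<^sup>2 * L) - sqrt (L * (\<kappa> ^ 4 * exp (\<kappa>\<^sup>2) / n))" "0 < \<eta>"
      "exp (3 * \<kappa> * sqrt L) * sqrt (2 * (L * exp (8 * \<kappa>\<^sup>2))) / n \<le> \<eta>"
    and t: "0 < \<epsilon>" "real n \<le> 2 ^ t * \<epsilon>"
  shows "1 - (4 / L + 125 * \<rho> * \<kappa> ^ 3 / n) \<le>
    measure M {R \<in> space M. norm (1 - rook_approx t n R / per n R) \<le> \<epsilon>}"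
proof -
  define z where "z = 1 / \<mu>"
  have z: "norm z \<le> \<kappa>" using assms by (simp add: z_def norm_divide)
  define u1 where "u1 = (\<lambda>R. (norm ((\<Sum>s\<in>cells. R s - \<mu>) / of_nat n))\<^sup>2)"
  define u2 where "u2 = (\<lambda>R. \<Sum>s\<in>cells. norm (R s - \<mu>) ^ 2)"
  define u3 where "u3 = (\<lambda>R. \<Sum>s\<in>cells. norm (R s - \<mu>) ^ 3)"
  define u4 where "u4 = (\<lambda>R. (norm (\<Sum>S\<in>Pow cells. dev_coeff n z S * (\<Prod>s\<in>S. R s - \<mu>)))\<^sup>2)"
  define u5 where "u5 = (\<lambda>R. \<Sum>l\<le>n. 8 ^ l * ((norm z)\<^sup>2) ^ l * (norm (rook_coeff n (\<lambda>s. R s - \<mu>) l))\<^sup>2)"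
  define b4 where "b4 = \<kappa> ^ 4 * exp (\<kappa>\<^sup>2) / n"
  define b5 where "b5 = exp (8 * \<kappa>\<^sup>2)"
  define B where "B = (\<lambda>u c. {R \<in> space M. c \<le> (u R :: real)})"
  have b: "0 < b4" "0 < b5" using assms n_pos by (simp_all add: b4_def b5_def)
  have u1: "integrable M u1" "(LINT R|M. u1 R) \<le> 1"
  proof -
    \<comment> \<open>The normalized sum of centred entries is a combination of the singleton
      monomials, so Parseval applies.\<close>
    have inj: "inj_on (\<lambda>s. {s}) cells" by simp
    have eq: "u1 = (\<lambda>R. (norm (\<Sum>S\<in>(\<lambda>s. {s}) ` cells. (1 / of_nat n) * chi S R))\<^sup>2)"
      by (simp add: u1_def chi_def sum.reindex[OF inj] o_def sum_divide_distrib)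
    have F: "(\<lambda>s. {s}) ` cells \<subseteq> Pow cells" by auto
    show "integrable M u1" unfolding eq by (rule chi_parseval(1)[OF F])
    have "(LINT R|M. u1 R) = (\<Sum>S\<in>(\<lambda>s. {s}) ` cells. (norm (1 / of_nat n :: complex))\<^sup>2)"
      unfolding eq by (rule chi_parseval(2)[OF F])
    also have "\<dots> = 1"
      using n_pos by (simp add: card_image[OF inj] norm_divide card_cartesian_product power2_eq_square)
    finally show "(LINT R|M. u1 R) \<le> 1" by simp
  qed
  have u2: "integrable M u2" "(LINT R|M. u2 R) \<le> real n ^ 2"
    unfolding u2_def using coordinate[OF _ integrable_square]
    by (auto simp: Bochner_Integration.integral_sum variance card_cartesian_product power2_eq_square[of "real n"])
  have u3: "integrable M u3" "(LINT R|M. u3 R) \<le> real n ^ 2 * \<rho>"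
    unfolding u3_def using coordinate[OF _ integrable_cube]
    by (auto simp: Bochner_Integration.integral_sum third_moment card_cartesian_product power2_eq_square[of "real n"])
  have u4: "integrable M u4" "(LINT R|M. u4 R) \<le> b4"
  proof -
    have "(LINT R|M. u4 R) = (\<Sum>S\<in>Pow cells. (norm (dev_coeff n z S))\<^sup>2)"
      unfolding u4_def chi_def[symmetric] by (rule chi_parseval(2)) simp
    also have "\<dots> \<le> norm z ^ 4 * exp ((norm z)\<^sup>2) / n" by (rule sum_dev_coeff[OF n_pos])
    also have "\<dots> \<le> b4" unfolding b4_def
      using z by (intro divide_right_mono mult_mono power_mono) (auto intro!: power_mono)
    finally show "(LINT R|M. u4 R) \<le> b4" .
    show "integrable M u4" unfolding u4_def chi_def[symmetric] by (rule chi_parseval(1)) simp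
  qed
  have u5: "integrable M u5" "(LINT R|M. u5 R) \<le> b5"
  proof -
    show "integrable M u5" unfolding u5_def
      by (intro Bochner_Integration.integrable_sum integrable_mult_right rook_coeff_second_moment) simp
    have "(LINT R|M. u5 R) = (\<Sum>l\<le>n. (8 * (norm z)\<^sup>2) ^ l / fact l)"
      unfolding u5_def
      by (subst Bochner_Integration.integral_sum)
         (auto simp: rook_coeff_second_moment power_mult_distrib intro!: sum.cong)
    also have "\<dots> \<le> exp (8 * (norm z)\<^sup>2)" by (rule sum_power_div_fact_le_exp) auto
    also have "\<dots> \<le> b5" unfolding b5_def using z by (simp add: power_mono)
    finally show "(LINT R|M. u5 R) \<le> b5" .
  qed
  have "measure M (B u1 L) \<le> 1 / L"
    unfolding B_def by (rule markov[OF u1(1) _ u1(2)]) (use assms in \<open>auto simp: u1_def\<close>)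
  moreover have "measure M (B u2 (L * real n ^ 2)) \<le> real n ^ 2 / (L * real n ^ 2)"
    unfolding B_def by (rule markov[OF u2(1) _ u2(2)]) (use assms n_pos in \<open>auto simp: u2_def intro!: sum_nonneg\<close>)
  moreover have "measure M (B u3 ((n / (5 * \<kappa>)) ^ 3)) \<le> real n ^ 2 * \<rho> / (n / (5 * \<kappa>)) ^ 3"
    unfolding B_def by (rule markov[OF u3(1) _ u3(2)]) (use assms n_pos in \<open>auto simp: u3_def intro!: sum_nonneg\<close>)
  moreover have "measure M (B u4 (L * b4)) \<le> b4 / (L * b4)"
    unfolding B_def by (rule markov[OF u4(1) _ u4(2)]) (use assms b in \<open>auto simp: u4_def\<close>)
  moreover have "measure M (B u5 (L * b5)) \<le> b5 / (L * b5)"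
    unfolding B_def by (rule markov[OF u5(1) _ u5(2)]) (use assms b in \<open>auto simp: u5_def intro!: sum_nonneg\<close>)
  moreover have "real n ^ 2 / (L * real n ^ 2) = 1 / L" "b4 / (L * b4) = 1 / L" "b5 / (L * b5) = 1 / L"
    using b n_pos by simp_all
  moreover have "real n ^ 2 * \<rho> / (n / (5 * \<kappa>)) ^ 3 = 125 * \<rho> * \<kappa> ^ 3 / n"
    using n_pos assms by (simp add: power_divide power_mult_distrib power2_eq_square power3_eq_cube)
  ultimately have sum: "measure M (B u1 L) + measure M (B u2 (L * real n ^ 2)) + measure M (B u3 ((n / (5 * \<kappa>)) ^ 3)) +
      measure M (B u4 (L * b4)) + measure M (B u5 (L * b5)) \<le> 4 / L + 125 * \<rho> * \<kappa> ^ 3 / n"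
    by linarith
  have B_sets: "B u c \<in> sets M" if "integrable M u" for u c
    using borel_measurable_integrable[OF that] unfolding B_def by measurable
  define U where "U = B u1 L \<union> B u2 (L * real n ^ 2) \<union> B u3 ((n / (5 * \<kappa>)) ^ 3) \<union> B u4 (L * b4) \<union> B u5 (L * b5)"
  have U: "U \<in> sets M" unfolding U_def using B_sets u1 u2 u3 u4 u5 by (intro sets.Un) auto
  have "measure M U \<le> 4 / L + 125 * \<rho> * \<kappa> ^ 3 / n"
  proof -
    have Un: "measure M (V \<union> W) \<le> measure M V + measure M W" if "V \<in> sets M" "W \<in> sets M" for V W
      using that by (rule measure_Un_le)
    have "measure M U \<le> measure M (B u1 L) + measure M (B u2 (L * real n ^ 2)) + measure M (B u3 ((n / (5 * \<kappa>)) ^ 3)) +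
      measure M (B u4 (L * b4)) + measure M (B u5 (L * b5))"
      unfolding U_def using B_sets u1 u2 u3 u4 u5
      by (intro order_trans[OF Un] add_mono order_refl) auto
    with sum show ?thesis by linarith
  qed
  then have "1 - (4 / L + 125 * \<rho> * \<kappa> ^ 3 / n) \<le> 1 - measure M U" by simp
  also have "\<dots> = measure M (space M - U)" using U by (simp add: M.prob_compl)
  also have "\<dots> \<le> measure M {R \<in> space M. norm (1 - rook_approx t n R / per n R) \<le> \<epsilon>}"
  proof (rule M.finite_measure_mono)
    show "{R \<in> space M. norm (1 - rook_approx t n R / per n R) \<le> \<epsilon>} \<in> sets M" by measurable
    show "space M - U \<subseteq> {R \<in> space M. norm (1 - rook_approx t n R / per n R) \<le> \<epsilon>}"
    proof
      fix R assume R: "R \<in> space M - U"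
      have "norm (1 - rook_approx t n R / per n R) \<le> \<epsilon>"
        by (rule rook_approx_accurate[where \<mu> = \<mu> and \<kappa> = \<kappa> and L = L and \<eta> = \<eta>])
           (use R assms n_pos z in \<open>auto simp: U_def B_def u1_def u2_def u3_def u4_def u5_def b4_def b5_def z_def not_le\<close>)
      then show "R \<in> {R \<in> space M. norm (1 - rook_approx t n R / per n R) \<le> \<epsilon>}" using R by simp
    qed
  qed
  finally show ?thesis .
qed

end

section \<open>The algorithm\<close>

definition scale_ok :: "nat \<Rightarrow> real \<Rightarrow> real \<Rightarrow> real \<Rightarrow> bool" where
  "scale_ok n \<kappa> L \<eta> \<longleftrightarrow>
     \<eta> \<le> exp (- \<kappa> * sqrt L - 5 * \<kappa>\<^sup>2 * L) - sqrt (L * (\<kappa> ^ 4 * exp (\<kappa>\<^sup>2) / real n)) \<and>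
     exp (3 * \<kappa> * sqrt L) * sqrt (2 * (L * exp (8 * \<kappa>\<^sup>2))) / real n \<le> \<eta>"

text \<open>With \<kappa> the eighth root and \<open>L\<close> the square root of
  \<open>ln n\<close>, every exponent is of smaller order than \<open>ln n\<close>, the largest
  being of order \<open>(ln n) powr (3 / 4)\<close>. The exponentials are thus subpolynomial, and
  \<open>n powr (-1 / 4)\<close> fits between them and the polynomial decay.\<close>

lemma eventually_scale_ok:
  "eventually (\<lambda>n. 1 \<le> ln (real n) \<and>
     scale_ok n (ln (real n) powr (1 / 8)) (sqrt (ln (real n))) (real n powr (-1 / 4))) sequentially"
  unfolding scale_ok_def
  by (intro eventually_conj) real_asymp+

text \<open>The program and \<open>C\<close> come first and the time bound covers every matrix. As
  \<delta> is chosen before \<mu>, \<open>D\<close> and \<epsilon>, the failure bound is uniform in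
  them for fixed \<open>c\<close> and \<rho>.\<close>

theorem theorem3p1:
  fixes c :: real
  assumes "0 < c" and "c < 1 / 8"
  shows "\<exists>(prog :: com) (P :: nat \<Rightarrow> cmatrix \<Rightarrow> real \<Rightarrow> complex).
    (\<exists>C::real. \<forall>n\<ge>2. \<forall>R. \<forall>\<epsilon>\<in>{0<..<1}.
       computes_within prog n R \<epsilon> (P n R \<epsilon>) (real n powr (C * (ln (real n) + ln (1 / \<epsilon>))))) \<and>
    (\<forall>\<rho>::real. \<exists>\<delta> \<in> o(\<lambda>_. 1 :: real). \<forall>n\<ge>2. \<forall>\<mu>::complex. \<forall>D. \<forall>\<epsilon>\<in>{0<..<1}.
       norm \<mu> \<ge> ln (real n) powr (- c) \<longrightarrow> entry_distribution \<mu> \<rho> D \<longrightarrow>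
       measure (iid_matrix n D)
         {R \<in> space (iid_matrix n D). norm (1 - P n R \<epsilon> / per n R) \<le> \<epsilon>} \<ge> 1 - \<delta> n)"
proof (intro exI[of _ rook_prog] exI[of _ "\<lambda>n R \<epsilon>. rook_approx (num_digits n \<epsilon>) n R"] conjI allI)
  show "\<exists>C::real. \<forall>n\<ge>2. \<forall>R. \<forall>\<epsilon>\<in>{0<..<1}.
      computes_within rook_prog n R \<epsilon> (rook_approx (num_digits n \<epsilon>) n R)
        (real n powr (C * (ln (real n) + ln (1 / \<epsilon>))))"
    using rook_prog_computes by (intro exI[of _ "29 / ln 2"]) auto
next
  fix \<rho> :: real
  define \<kappa> where "\<kappa> = (\<lambda>n::nat. ln (real n) powr (1 / 8))"
  define L where "L = (\<lambda>n::nat. sqrt (ln (real n)))"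
  define good where "good = (\<lambda>n. 1 \<le> ln (real n) \<and> scale_ok n (\<kappa> n) (L n) (real n powr (-1 / 4)))"
  \<comment> \<open>The default 1 makes the claim trivial for the finitely many \<open>n\<close>
    where the scales do not yet fit.\<close>
  define \<delta> where "\<delta> = (\<lambda>n. if good n then 4 / L n + 125 * \<rho> * \<kappa> n ^ 3 / real n else 1)"
  have "eventually good sequentially"
    unfolding good_def \<kappa>_def L_def by (rule eventually_scale_ok)
  then have "eventually (\<lambda>n. \<delta> n = 4 / L n + 125 * \<rho> * \<kappa> n ^ 3 / real n) sequentially"
    by eventually_elim (simp add: \<delta>_def)
  moreover have "(\<lambda>n. 4 / L n + 125 * \<rho> * \<kappa> n ^ 3 / real n) \<longlonglongrightarrow> 0"
  proof -
    have "(\<lambda>n. 4 / L n) \<longlonglongrightarrow> 0" "(\<lambda>n. \<kappa> n ^ 3 / real n) \<longlonglongrightarrow> 0"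
      unfolding L_def \<kappa>_def by real_asymp+
    from tendsto_add[OF this(1) tendsto_mult_left[OF this(2), of "125 * \<rho>"]] show ?thesis by simp
  qed
  ultimately have "\<delta> \<longlonglongrightarrow> 0" by (simp add: tendsto_cong)
  then have "\<delta> \<in> o(\<lambda>_. 1)" by (intro smalloI_tendsto) auto
  moreover have "1 - \<delta> n \<le> measure (iid_matrix n D)
      {R \<in> space (iid_matrix n D). norm (1 - rook_approx (num_digits n \<epsilon>) n R / per n R) \<le> \<epsilon>}"
    if "2 \<le> n" "\<epsilon> \<in> {0<..<1}" "ln (real n) powr (- c) \<le> norm \<mu>" "entry_distribution \<mu> \<rho> D"
    for n \<mu> D \<epsilon>
  proof (cases "good n")
    case True
    interpret random_matrix n \<mu> \<rho> D using that by unfold_locales auto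
    have l: "1 \<le> ln (real n)" using True by (simp add: good_def)
    then have pos: "0 < ln (real n) powr (- c)" by simp
    then have "\<mu> \<noteq> 0" using that(3) by auto
    have "1 / norm \<mu> \<le> 1 / ln (real n) powr (- c)" using that(3) pos \<open>\<mu> \<noteq> 0\<close> by (intro divide_left_mono mult_pos_pos) auto
    also have "\<dots> = ln (real n) powr c" by (simp add: powr_minus_divide)
    \<comment> \<open>This is where \<open>c < 1 / 8\<close> enters; \<open>ln n \<ge> 1\<close>
      makes the power monotone in its exponent.\<close>
    also have "\<dots> \<le> \<kappa> n" unfolding \<kappa>_def using l assms by (intro powr_mono) auto
    finally have "1 / norm \<mu> \<le> \<kappa> n" .
    moreover have "0 < \<kappa> n" "0 < L n" using l by (simp_all add: \<kappa>_def L_def)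
    ultimately show ?thesis
      using rook_approx_accurate_prob[OF \<open>\<mu> \<noteq> 0\<close>, of "\<kappa> n" "L n" "real n powr (-1 / 4)" \<epsilon> "num_digits n \<epsilon>"]
        num_digits(1)[of \<epsilon> n] True that
      by (simp add: good_def scale_ok_def \<delta>_def)
  next
    case False
    then show ?thesis by (simp add: \<delta>_def)
  qed
  ultimately show "\<exists>\<delta> \<in> o(\<lambda>_. 1 :: real). \<forall>n\<ge>2. \<forall>\<mu>::complex. \<forall>D. \<forall>\<epsilon>\<in>{0<..<1}.
       norm \<mu> \<ge> ln (real n) powr (- c) \<longrightarrow> entry_distribution \<mu> \<rho> D \<longrightarrow>
       measure (iid_matrix n D)
         {R \<in> space (iid_matrix n D). norm (1 - rook_approx (num_digits n \<epsilon>) n R / per n R) \<le> \<epsilon>} \<ge> 1 - \<delta> n"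
    by (intro bexI[of _ \<delta>]) auto
qed

end
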